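(* If $T$ is a rational map and its Julia set $J(T)$ contains a Cremer point, then $\dim_{\mathrm A}J(T)=2$.
   Context: $T:\hat{\mathbb C}\to\hat{\mathbb C}$ is a rational map of degree at least $2$ and $J(T)$ is its Julia set (the closure of the set of repelling periodic points). It is assumed throughout that $J(T)\ne\hat{\mathbb C}$ and, after conjugating by a Möbius map if necessary, that $J(T)$ is a compact subset of $\mathbb C\cong\mathbb R^2$. A *Cremer point* of $T$ is a non-linearisable irrationally indifferent fixed point: a point $\omega$ with $T(\omega)=\omega$ and $T'(\omega)=e^{2\pi i\alpha}$ for some real $\alpha\notin\mathbb Q$, such that $T$ is not conjugate, by a local holomorphic change of coordinates near $\omega$, to the rotation $z\mapsto e^{2\pi i\alpha}z$ near $0$. For $F\subseteq\mathbb R^d$ with diameter $|F|$, let $N_r(F)$ be the least number of open balls of radius $r$ needed to cover $F$ and let $B(x,R)$ be the open ball with centre $x$ and radius $R$. The Assouad dimension of $F$ is $$\dim_{\mathrm A}F=\inf\{s\ge0:\exists C>0\ \forall\,0<r<R<|F|\ \forall x\in F:\ N_r(B(x,R)\cap F)\le C(R/r)^s\}.$$ *)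

theory Defs
  imports "HOL-Analysis.Analysis" "HOL-Computational_Algebra.Polynomial"
begin

section \<open>The Riemann sphere and rational maps\<close>

text \<open>The Riemann sphere is the one-point compactification of the complex plane;
  \<^term>\<open>None\<close> is the point at infinity.\<close>

type_synonym sphere = "complex option"

abbreviation sphere_top :: "sphere topology" where
  "sphere_top \<equiv> Alexandroff_compactification euclidean"

text \<open>For coprime \<open>p\<close>, \<open>q\<close> of maximal degree \<open>d\<close>, this is the continuous extension of \<open>p/q\<close> to
  the sphere. In homogeneous form the value at infinity is the quotient of the coefficients of
  index \<open>d\<close>; it is infinite precisely when the degree of \<open>q\<close> is less than \<open>d\<close>.\<close>

definition rational_fun :: "complex poly \<Rightarrow> complex poly \<Rightarrow> sphere \<Rightarrow> sphere" where
  "rational_fun p q x =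
     (case x of
        Some z \<Rightarrow> if poly q z = 0 then None else Some (poly p z / poly q z)
      | None \<Rightarrow> (let d = max (degree p) (degree q) in
                 if coeff q d = 0 then None else Some (coeff p d / coeff q d)))"

definition rational_map_of_degree :: "(sphere \<Rightarrow> sphere) \<Rightarrow> nat \<Rightarrow> bool" where
  "rational_map_of_degree T d \<longleftrightarrow>
     (\<exists>p q. coprime p q \<and> max (degree p) (degree q) = d \<and> T = rational_fun p q)"


section \<open>Multipliers, the Julia set and Cremer points\<close>

text \<open>The standard holomorphic coordinate centred at a point \<open>x\<close>: \<open>z - a\<close> for \<open>x = a\<close> finite and
  \<open>1/z\<close> at infinity. Each chart omits one point of the sphere (infinity in the first case, zero
  in the second), where its value is a dummy; only germs at \<open>x\<close> are used below.\<close>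

definition chart :: "sphere \<Rightarrow> sphere \<Rightarrow> complex" where
  "chart x y =
     (case x of
        Some a \<Rightarrow> (case y of Some z \<Rightarrow> z - a | None \<Rightarrow> 0)
      | None \<Rightarrow> (case y of Some z \<Rightarrow> 1 / z | None \<Rightarrow> 0))"

definition chart_inv :: "sphere \<Rightarrow> complex \<Rightarrow> sphere" where
  "chart_inv x w =
     (case x of
        Some a \<Rightarrow> Some (a + w)
      | None \<Rightarrow> if w = 0 then None else Some (1 / w))"

text \<open>The expression of \<open>T\<close> in the chart at a fixed point \<open>x\<close>; it fixes \<open>0\<close>.\<close>

definition local_rep :: "(sphere \<Rightarrow> sphere) \<Rightarrow> sphere \<Rightarrow> complex \<Rightarrow> complex" where
  "local_rep T x w = chart x (T (chart_inv x w))"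

text \<open>The derivative \<open>T'(x)\<close> at a fixed point \<open>x\<close> of \<open>T\<close>.\<close>

definition multiplier :: "(sphere \<Rightarrow> sphere) \<Rightarrow> sphere \<Rightarrow> complex" where
  "multiplier T x = deriv (local_rep T x) 0"

lemma multiplier_Some:
  assumes "T (Some a) = Some a" and "\<forall>\<^sub>F z in nhds a. T (Some z) = Some (f z)"
  shows "multiplier T (Some a) = deriv f a"
proof -
  have "((\<lambda>w. a + w) \<longlongrightarrow> a) (nhds 0)"
    using tendsto_add[OF tendsto_const[of a] filterlim_ident[of "nhds 0"]] by simp
  then have "\<forall>\<^sub>F w in nhds 0. T (Some (a + w)) = Some (f (a + w))"
    using assms(2) by (auto simp: filterlim_iff)
  then have "\<forall>\<^sub>F w in nhds 0. local_rep T (Some a) w = f (a + w) - a"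
    by eventually_elim (simp add: local_rep_def chart_def chart_inv_def)
  then have "multiplier T (Some a) = deriv (\<lambda>w. f (a + w) - a) 0"
    unfolding multiplier_def by (intro deriv_cong_ev) auto
  also have "\<dots> = deriv f a"
  proof -
    have "((\<lambda>w. f (a + w) - a) has_field_derivative D) (at 0)
        \<longleftrightarrow> (f has_field_derivative D) (at a)" for D
    proof
      assume "((\<lambda>w. f (a + w) - a) has_field_derivative D) (at 0)"
      from DERIV_add[OF this DERIV_const[of a]]
      show "(f has_field_derivative D) (at a)"
        using DERIV_shift[of f D 0 a] by (simp add: add.commute)
    next
      assume "(f has_field_derivative D) (at a)"
      then have "((\<lambda>w. f (a + w)) has_field_derivative D) (at 0)"
        using DERIV_shift[of f D 0 a] by (simp add: add.commute)
      from DERIV_diff[OF this DERIV_const[of a]]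
      show "((\<lambda>w. f (a + w) - a) has_field_derivative D) (at 0)" by simp
    qed
    then show ?thesis by (simp add: deriv_def)
  qed
  finally show ?thesis .
qed

definition repelling_periodic_point :: "(sphere \<Rightarrow> sphere) \<Rightarrow> sphere \<Rightarrow> bool" where
  "repelling_periodic_point T x \<longleftrightarrow>
     (\<exists>n>0. (T ^^ n) x = x \<and> norm (multiplier (T ^^ n) x) > 1)"

definition julia_set :: "(sphere \<Rightarrow> sphere) \<Rightarrow> sphere set" where
  "julia_set T = sphere_top closure_of {x. repelling_periodic_point T x}"

text \<open>Near the fixed point \<open>x\<close>, some local holomorphic coordinate \<open>h\<close> vanishing at \<open>x\<close>
  conjugates \<open>T\<close> to multiplication by \<open>c\<close>.\<close>

definition locally_conjugate_to_linear :: "(sphere \<Rightarrow> sphere) \<Rightarrow> sphere \<Rightarrow> complex \<Rightarrow> bool" where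
  "locally_conjugate_to_linear T x c \<longleftrightarrow>
     (\<exists>U h. open U \<and> 0 \<in> U \<and> h holomorphic_on U \<and> inj_on h U \<and> h 0 = 0 \<and>
        (\<forall>\<^sub>F w in nhds 0. local_rep T x w \<in> U \<and> h (local_rep T x w) = c * h w))"

definition cremer_point :: "(sphere \<Rightarrow> sphere) \<Rightarrow> sphere \<Rightarrow> bool" where
  "cremer_point T x \<longleftrightarrow>
     T x = x \<and>
     (\<exists>\<alpha>::real. \<alpha> \<notin> \<rat> \<and>
        multiplier T x = exp (2 * of_real pi * \<i> * of_real \<alpha>) \<and>
        \<not> locally_conjugate_to_linear T x (exp (2 * of_real pi * \<i> * of_real \<alpha>)))"


section \<open>Assouad dimension\<close>

text \<open>The balls may be centred anywhere in the ambient space. The set of admissible \<open>n\<close> is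
  nonempty when \<open>F\<close> is bounded and \<open>r > 0\<close>.\<close>

definition covering_number :: "real \<Rightarrow> 'a::euclidean_space set \<Rightarrow> nat" where
  "covering_number r F =
     (LEAST n. \<exists>C. finite C \<and> card C = n \<and> F \<subseteq> (\<Union>c\<in>C. ball c r))"

text \<open>\<^const>\<open>diameter\<close> is \<open>0\<close> by convention on unbounded sets, whose diameter is to be read here as
  infinite; hence the guard on \<open>R < |F|\<close>.\<close>

definition assouad_dim :: "'a::euclidean_space set \<Rightarrow> real" where
  "assouad_dim F =
     Inf {s. s \<ge> 0 \<and>
       (\<exists>C>0. \<forall>r R. 0 < r \<and> r < R \<and> (bounded F \<longrightarrow> R < diameter F) \<longrightarrow>
          (\<forall>x\<in>F. real (covering_number r (ball x R \<inter> F)) \<le> C * (R / r) powr s))}"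

end

theory Submission
  imports Defs "HOL-Complex_Analysis.Complex_Analysis"
    "HOL-Computational_Algebra.Fundamental_Theorem_Algebra"
begin

text \<open>
  If the dimension is less than 2, comparing areas gives a constant \<open>c\<close> such that every disc of small
  radius \<open>R\<close> about the Cremer point \<open>a\<close> contains a disc of radius \<open>c R\<close> which misses \<open>J\<close>. The
  iterates of \<open>T\<close> near \<open>a\<close> are close to irrational rotations, so the images of such a disc fill up
  a round annulus about \<open>a\<close>, of modulus bounded below, on which all iterates of \<open>T\<close> omit \<open>a\<close> and
  all but finitely many repelling periodic points. Schottky's theorem, used along the core circle
  \<open>|z - a| = s\<close>, shows that if the circle ever left a fixed disc about \<open>a\<close>, then at the first such
  time its image would stay at a distance \<open>\<sigma>\<close> from \<open>a\<close> with \<open>\<sigma>\<close> independent of \<open>s\<close>; for \<open>s < \<sigma>\<close> this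
  contradicts the maximum principle, because the iterate has a derivative of modulus one at \<open>a\<close>.
  Hence the iterates stay bounded near \<open>a\<close> and \<open>T\<close> is linearisable there.

  That the iterates omit repelling points off \<open>J\<close> does not need the theory of normal families
  beyond Schottky's theorem: all but finitely many repelling points \<open>w\<close> are outside every forward
  orbit of a critical point or of infinity, so that inverse branches exist along their backward
  orbits, and a homoclinic orbit of \<open>w\<close> through \<open>x\<close> produces repelling points arbitrarily close to \<open>x\<close>.
\<close>

section \<open>Schottky's theorem on an annulus and irrational rotations\<close>

lemma local_holomorphic_inverse:
  assumes "f holomorphic_on S" "open S" "a \<in> S" "deriv f a \<noteq> 0"
  obtains V g where "open V" "f a \<in> V" "g holomorphic_on V" "g ` V \<subseteq> S"
    "\<And>v. v \<in> V \<Longrightarrow> f (g v) = v" "g (f a) = a"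
proof -
  obtain r where r: "r > 0" "ball a r \<subseteq> S" "open (f ` ball a r)" "inj_on f (ball a r)"
    using has_complex_derivative_locally_invertible[OF assms(1,3,2,4)] by blast
  have "f holomorphic_on ball a r"
    using assms(1) r(2) holomorphic_on_subset by blast
  then obtain g where g: "g holomorphic_on (f ` ball a r)"
    "\<And>z. z \<in> ball a r \<Longrightarrow> g (f z) = z"
    using holomorphic_has_inverse[OF _ open_ball r(4)] by metis
  show thesis
  proof (rule that[OF r(3) _ g(1)])
    show "f a \<in> f ` ball a r" using r(1) by auto
    show "g ` f ` ball a r \<subseteq> S" using g(2) r(2) by auto
    show "f (g v) = v" if "v \<in> f ` ball a r" for v using that g(2) by auto
    show "g (f a) = a" using g(2) r(1) by auto
  qed
qed

text \<open>Schottky's bound on the disc of radius \<open>2/3\<close>, for functions on the closed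
  unit disc that omit 0 and 1 and have modulus at most \<open>B\<close> at the centre.\<close>

definition schottky_bound :: "real \<Rightarrow> real" where
  "schottky_bound B = exp (pi * exp (pi * (2 + 2 * B + 12 * (2/3) / (1 - 2/3))))"

text \<open>Rescaling by \<open>3 * R / 4\<close> carries the closed unit disc into the open ball
  and turns the radius \<open>R / 2\<close> into \<open>2/3\<close>.\<close>

lemma schottky_disc:
  fixes u :: "complex \<Rightarrow> complex"
  assumes hol: "u holomorphic_on ball z R"
    and avoid: "\<And>w. w \<in> ball z R \<Longrightarrow> u w \<noteq> 0 \<and> u w \<noteq> 1"
    and B: "norm (u z) \<le> B" and w: "dist z w \<le> R / 2" and "0 < R"
  shows "norm (u w) \<le> schottky_bound B"
proof -
  define k where "k = complex_of_real (3 * R / 4)"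
  have nk: "norm k = 3 * R / 4" using \<open>0 < R\<close> by (simp add: k_def)
  have k0: "k \<noteq> 0" using \<open>0 < R\<close> by (simp add: k_def)
  define v where "v = (\<lambda>\<zeta>. u (z + k * \<zeta>))"
  have in_ball: "z + k * \<zeta> \<in> ball z R" if "\<zeta> \<in> cball 0 1" for \<zeta>
  proof -
    have "norm (k * \<zeta>) \<le> 3 * R / 4 * 1"
      unfolding norm_mult nk using that \<open>0 < R\<close> by (intro mult_left_mono) auto
    then show ?thesis using \<open>0 < R\<close> by (auto simp: dist_norm)
  qed
  have "(u \<circ> (\<lambda>\<zeta>. z + k * \<zeta>)) holomorphic_on cball 0 1"
    by (rule holomorphic_on_compose_gen[OF _ hol]) (use in_ball in \<open>auto intro!: holomorphic_intros\<close>)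
  then have hv: "v holomorphic_on cball 0 1" by (simp add: v_def comp_def)
  have "norm (v ((w - z) / k)) \<le> exp (pi * exp (pi * (2 + 2 * B + 12 * (2/3) / (1 - 2/3))))"
  proof (rule Schottky[OF hv])
    show "norm (v 0) \<le> B" using B by (simp add: v_def)
    show "\<not> (v \<zeta> = 0 \<or> v \<zeta> = 1)" if "\<zeta> \<in> cball 0 1" for \<zeta>
      using avoid[OF in_ball[OF that]] by (simp add: v_def)
    show "norm ((w - z) / k) \<le> 2/3"
      unfolding norm_divide nk using w \<open>0 < R\<close>
      by (simp add: dist_norm norm_minus_commute field_simps)
  qed auto
  then show ?thesis using k0 by (simp add: v_def schottky_bound_def)
qed

lemma norm_cis_diff_le: "norm (cis x - cis y) \<le> \<bar>x - y\<bar>"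
proof -
  have "norm (cis x - cis y) = norm (cis y * (cis (x - y) - 1))"
    by (simp add: cis_mult algebra_simps)
  also have "\<dots> = norm (exp (\<i> * of_real (x - y)) - 1)"
    by (simp add: norm_mult) (simp add: cis_conv_exp)
  also have "\<dots> = 2 * \<bar>sin ((x - y) / 2)\<bar>"
    by (rule dist_exp_i_1)
  also have "\<dots> \<le> 2 * \<bar>(x - y) / 2\<bar>"
    by (rule mult_left_mono[OF abs_sin_x_le_abs_x]) simp
  finally show ?thesis by simp
qed

text \<open>A chain of discs centred on the circle transports the bound of Schottky's theorem.\<close>

lemma schottky_circle:
  assumes "0 < c"
  shows "\<exists>B'>0. \<forall>u s z w. 0 < s \<longrightarrow> u holomorphic_on {v. \<bar>norm v - s\<bar> < c * s} \<longrightarrow>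
    (\<forall>v. \<bar>norm v - s\<bar> < c * s \<longrightarrow> u v \<noteq> 0 \<and> u v \<noteq> 1) \<longrightarrow> norm z = s \<longrightarrow> norm w = s \<longrightarrow>
    norm (u z) \<le> B \<longrightarrow> norm (u w) \<le> (B'::real)"
proof -
  \<comment> \<open>With more than \<open>4 * pi / c\<close> arcs each chord has length at most
    \<open>c * s / 2\<close>, half the radius of the discs in which \<open>schottky_disc\<close> is
    applied.\<close>
  obtain N :: nat where N: "real N > 4 * pi / c" using reals_Archimedean2 by blast
  have N0: "real N > 0" by (rule le_less_trans[OF _ N]) (use assms in auto)
  define B' where "B' = (schottky_bound ^^ N) B"
  have "B' > 0" using N0 by (cases N) (simp_all add: B'_def schottky_bound_def)
  moreover have "norm (u w) \<le> B'" if s: "0 < s"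
    and hol: "u holomorphic_on {v. \<bar>norm v - s\<bar> < c * s}"
    and av: "\<And>v. \<bar>norm v - s\<bar> < c * s \<Longrightarrow> u v \<noteq> 0 \<and> u v \<noteq> 1"
    and z: "norm z = s" and w: "norm w = s" and B: "norm (u z) \<le> B" for u s z w
  proof -
    define \<phi> where "\<phi> = Arg2pi (w / z)"
    have \<phi>: "0 \<le> \<phi>" "\<phi> < 2 * pi" by (auto simp: \<phi>_def Arg2pi)
    have "norm (w / z) = 1" using z w s by (simp add: norm_divide)
    then have wz: "w = z * cis \<phi>"
      using Arg2pi_eq[of "w / z"] z s by (auto simp: \<phi>_def cis_conv_exp field_simps)
    define p where "p = (\<lambda>i::nat. z * cis (real i * \<phi> / N))"
    have np: "norm (p i) = s" for i by (simp add: p_def norm_mult z)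
    have sub: "ball (p i) (c * s) \<subseteq> {v. \<bar>norm v - s\<bar> < c * s}" for i
    proof
      fix v assume "v \<in> ball (p i) (c * s)"
      then have "norm (v - p i) < c * s" by (simp add: dist_norm norm_minus_commute)
      moreover have "\<bar>norm v - norm (p i)\<bar> \<le> norm (v - p i)" by (rule norm_triangle_ineq3)
      ultimately show "v \<in> {v. \<bar>norm v - s\<bar> < c * s}" using np by simp
    qed
    have step: "dist (p i) (p (Suc i)) \<le> c * s / 2" for i
    proof -
      have "dist (p i) (p (Suc i)) = s * norm (cis (real i * \<phi> / N) - cis (real (Suc i) * \<phi> / N))"
        by (simp add: p_def dist_norm z norm_mult flip: right_diff_distrib)
      also have "\<dots> \<le> s * \<bar>real i * \<phi> / N - real (Suc i) * \<phi> / N\<bar>"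
        using s norm_cis_diff_le by (intro mult_left_mono) auto
      also have "\<bar>real i * \<phi> / N - real (Suc i) * \<phi> / N\<bar> = \<phi> / N"
        using \<phi> N0 by (simp add: field_simps abs_if)
      also have "\<phi> / N \<le> c / 2"
      proof -
        have "\<phi> \<le> 2 * pi" using \<phi> by simp
        also have "2 * pi \<le> c / 2 * N" using N assms by (simp add: field_simps)
        finally show ?thesis using N0 by (simp add: field_simps)
      qed
      finally show ?thesis using s by (simp add: algebra_simps)
    qed
    have "norm (u (p i)) \<le> (schottky_bound ^^ i) B" for i
    proof (induction i)
      case 0
      then show ?case using B by (simp add: p_def)
    next
      case (Suc i)
      have "norm (u (p (Suc i))) \<le> schottky_bound ((schottky_bound ^^ i) B)"
      proof (rule schottky_disc[where u = u and z = "p i" and w = "p (Suc i)" and R = "c * s"])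
        show "u holomorphic_on ball (p i) (c * s)" using hol sub holomorphic_on_subset by blast
        show "u v \<noteq> 0 \<and> u v \<noteq> 1" if "v \<in> ball (p i) (c * s)" for v
          using av sub that by blast
      qed (use assms s Suc.IH step in auto)
      then show ?case by simp
    qed
    from this[of N] show ?thesis using N0 by (simp add: B'_def p_def wz)
  qed
  ultimately show ?thesis by blast
qed

text \<open>Cauchy's estimate on discs of radius \<open>R/8\<close> about points of
  \<open>cball z (R/4)\<close>: these discs lie in \<open>cball z (R/2)\<close>, where Schottky's
  bound holds.\<close>

lemma schottky_lipschitz:
  fixes u :: "complex \<Rightarrow> complex"
  assumes hol: "u holomorphic_on ball z R"
    and avoid: "\<And>w. w \<in> ball z R \<Longrightarrow> u w \<noteq> 0 \<and> u w \<noteq> 1"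
    and B: "norm (u z) \<le> B" and w: "dist z w \<le> R / 4" and "0 < R"
  shows "norm (u w - u z) \<le> schottky_bound B / (R / 8) * dist z w"
proof -
  have "norm (u w - u z) \<le> schottky_bound B / (R / 8) * norm (w - z)"
  proof (rule field_differentiable_bound[of "cball z (R/4)" u "deriv u"])
    fix x assume x: "x \<in> cball z (R/4)"
    then have "x \<in> ball z R" using \<open>0 < R\<close> by auto
    then show "(u has_field_derivative deriv u x) (at x within cball z (R/4))"
      using holomorphic_derivI[OF hol open_ball] by (simp add: has_field_derivative_at_within)
    have sub: "cball x (R/8) \<subseteq> ball z R" "cball x (R/8) \<subseteq> cball z (R/2)"
      using x \<open>0 < R\<close> by (auto simp: cball_subset_ball_iff cball_subset_cball_iff dist_commute)
    have "norm ((deriv ^^ 1) u x) \<le> fact 1 * schottky_bound B / (R/8) ^ 1"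
    proof (rule Cauchy_inequality)
      show "u holomorphic_on ball x (R/8)"
        using hol sub(1) ball_subset_cball holomorphic_on_subset by blast
      show "continuous_on (cball x (R/8)) u"
        using hol sub(1) holomorphic_on_imp_continuous_on holomorphic_on_subset by blast
      show "norm (u y) \<le> schottky_bound B" if "norm (x - y) = R/8" for y
      proof (rule schottky_disc[OF hol avoid B _ \<open>0 < R\<close>])
        show "dist z y \<le> R / 2"
          using that sub(2) by (metis dist_norm mem_cball order_refl subsetD)
      qed
    qed (use \<open>0 < R\<close> in auto)
    then show "norm (deriv u x) \<le> schottky_bound B / (R/8)" by simp
  qed (use w \<open>0 < R\<close> in auto)
  then show ?thesis by (simp add: dist_norm norm_minus_commute)
qed

text \<open>Kronecker's theorem gives each point of the circle its own exponent; compactness of the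
  circle makes the bound \<open>N\<close> uniform.\<close>

lemma rotation_dense:
  assumes "\<alpha> \<notin> \<rat>" "0 < \<eta>"
  shows "\<exists>N. \<forall>\<zeta>::complex. norm \<zeta> = 1 \<longrightarrow> (\<exists>n\<le>N. norm (exp (2 * of_real pi * \<i> * of_real \<alpha>) ^ n - \<zeta>) < \<eta>)"
proof -
  define \<mu> where "\<mu> = exp (2 * of_real pi * \<i> * complex_of_real \<alpha>)"
  have \<mu>: "\<mu> ^ n = cis (2 * pi * frac (real n * \<alpha>))" for n
  proof -
    have "\<mu> ^ n = exp (of_nat n * (2 * of_real pi * \<i> * complex_of_real \<alpha>))"
      by (simp only: \<mu>_def exp_of_nat_mult)
    also have "\<dots> = cis (2 * pi * (real n * \<alpha>))"
      by (simp add: cis_conv_exp mult_ac)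
    also have "\<dots> = cis (2 * pi * frac (real n * \<alpha>) + 2 * pi * of_int \<lfloor>real n * \<alpha>\<rfloor>)"
      by (simp add: frac_def algebra_simps)
    also have "\<dots> = cis (2 * pi * frac (real n * \<alpha>))"
      by (simp flip: cis_mult)
    finally show ?thesis .
  qed
  have cover: "\<exists>n. norm (\<mu> ^ n - \<zeta>) < \<eta>" if "norm \<zeta> = 1" for \<zeta>
  proof -
    define t where "t = Arg2pi \<zeta> / (2 * pi)"
    have t: "0 \<le> t" "t \<le> 1" using Arg2pi[of \<zeta>] by (auto simp: t_def field_simps)
    have \<zeta>: "\<zeta> = cis (2 * pi * t)"
      using Arg2pi_eq[of \<zeta>] that by (simp add: t_def cis_conv_exp)
    obtain k where k: "\<bar>frac (real k * \<alpha>) - t\<bar> < \<eta> / (2 * pi)"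
      using Kronecker_approx_1_explicit[OF assms(1) t, of "\<eta> / (2 * pi)"] assms(2) by auto
    have "norm (\<mu> ^ k - \<zeta>) \<le> \<bar>2 * pi * frac (real k * \<alpha>) - 2 * pi * t\<bar>"
      unfolding \<mu> \<zeta> by (rule norm_cis_diff_le)
    also have "\<dots> = 2 * pi * \<bar>frac (real k * \<alpha>) - t\<bar>"
      by (simp add: abs_mult flip: right_diff_distrib)
    also have "\<dots> < \<eta>" using k by (simp add: field_simps)
    finally show ?thesis by blast
  qed
  then have "sphere 0 1 \<subseteq> (\<Union>n\<in>(UNIV::nat set). ball (\<mu> ^ n) \<eta>)" by (auto simp: dist_norm)
  then obtain C where C: "finite C" "sphere 0 1 \<subseteq> (\<Union>n\<in>C. ball (\<mu> ^ n) \<eta>)"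
    using compactE_image[where S = "sphere 0 1" and C = "UNIV :: nat set" and f = "\<lambda>n. ball (\<mu> ^ n) \<eta>"]
    by (metis compact_sphere open_ball)
  obtain N where N: "\<forall>n\<in>C. n \<le> N" using C(1) finite_nat_set_iff_bounded_le by auto
  have "\<forall>\<zeta>. norm \<zeta> = 1 \<longrightarrow> (\<exists>n\<le>N. norm (\<mu> ^ n - \<zeta>) < \<eta>)"
  proof (intro allI impI)
    fix \<zeta> :: complex assume "norm \<zeta> = 1"
    then have "\<zeta> \<in> sphere 0 1" by simp
    then obtain n where "n \<in> C" "\<zeta> \<in> ball (\<mu> ^ n) \<eta>" using C(2) by blast
    then show "\<exists>n\<le>N. norm (\<mu> ^ n - \<zeta>) < \<eta>" using N by (auto simp: dist_norm)
  qed
  then show ?thesis unfolding \<mu>_def by blast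
qed

section \<open>Irrationally indifferent fixed points\<close>

lemma iterates_holomorphic:
  assumes "f holomorphic_on S" "\<And>j z. j < k \<Longrightarrow> z \<in> A \<Longrightarrow> (f ^^ j) z \<in> S"
  shows "(f ^^ k) holomorphic_on A"
  using assms(2)
proof (induction k)
  case 0
  then show ?case by (simp add: id_def)
next
  case (Suc k)
  have "(f \<circ> (f ^^ k)) holomorphic_on A"
  proof (rule holomorphic_on_compose_gen[OF _ assms(1)])
    show "(f ^^ k) holomorphic_on A" using Suc by simp
    show "(f ^^ k) ` A \<subseteq> S" using Suc.prems by auto
  qed
  then show ?case by (simp add: comp_def)
qed

lemma iterates_derivative_at_fixpoint:
  assumes "(f has_field_derivative c) (at a)" "f a = a"
  shows "((f ^^ k) has_field_derivative c ^ k) (at a) \<and> (f ^^ k) a = a"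
proof (induction k)
  case 0
  then show ?case by (auto simp: id_def intro!: derivative_eq_intros)
next
  case (Suc k)
  then have "((\<lambda>x. f ((f ^^ k) x)) has_field_derivative c * c ^ k) (at a)"
    using assms by (intro DERIV_chain2[of f]) auto
  then show ?case using Suc assms(2) by (simp add: comp_def)
qed

text \<open>The linearising coordinate is a limit of the averages of \<open>f\<^sup>j / c\<^sup>j\<close>.\<close>

lemma linearisation_of_bounded_iterates:
  fixes f :: "complex \<Rightarrow> complex"
  assumes hol: "f holomorphic_on ball 0 \<rho>" and f0: "f 0 = 0"
    and der: "(f has_field_derivative c) (at 0)" and c: "norm c = 1" and r: "0 < r"
    and trap: "\<And>k z. z \<in> ball 0 r \<Longrightarrow> (f ^^ k) z \<in> ball 0 \<rho>"
  shows "\<exists>U h. open U \<and> 0 \<in> U \<and> h holomorphic_on U \<and> inj_on h U \<and> h 0 = 0 \<and>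
    (\<forall>\<^sub>F w in nhds 0. f w \<in> U \<and> h (f w) = c * h w)"
proof -
  have c0: "c \<noteq> 0" using c by auto
  define a where "a = (\<lambda>j z. (f ^^ j) z / c ^ j)"
  define \<phi> where "\<phi> = (\<lambda>n z. (\<Sum>j\<le>n. a j z) / of_nat (Suc n))"
  have hola: "a j holomorphic_on ball 0 r" for j
    unfolding a_def using trap c0
    by (intro holomorphic_intros iterates_holomorphic[OF hol]) auto
  have hol\<phi>: "\<phi> n holomorphic_on ball 0 r" for n
    unfolding \<phi>_def by (intro holomorphic_intros hola) (simp del: of_nat_Suc)
  have na: "norm (a j z) \<le> \<rho>" if "z \<in> ball 0 r" for j z
    using trap[OF that, of j] by (simp add: a_def norm_divide norm_power c)
  have n\<phi>: "norm (\<phi> n z) \<le> \<rho>" if "z \<in> ball 0 r" for n z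
  proof -
    have "norm (\<Sum>j\<le>n. a j z) \<le> of_nat (card {..n}) * \<rho>"
      by (rule sum_norm_bound) (use na that in auto)
    then show ?thesis by (simp add: \<phi>_def norm_divide field_simps del: of_nat_Suc)
  qed
  \<comment> \<open>The averages are bounded by \<rho>, so Montel's theorem gives a limit along a
    subsequence. All of them have derivative 1 at 0, hence so does the limit, which is therefore
    injective near 0.\<close>
  obtain g s where g: "g holomorphic_on ball 0 r" "strict_mono (s :: nat \<Rightarrow> nat)"
    "\<And>x. x \<in> ball 0 r \<Longrightarrow> (\<lambda>n. \<phi> (s n) x) \<longlonglongrightarrow> g x"
    "\<And>K. compact K \<Longrightarrow> K \<subseteq> ball 0 r \<Longrightarrow> uniform_limit K (\<phi> \<circ> s) g sequentially"
  proof (rule Montel[of "ball 0 r" "range \<phi>" \<phi>])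
    show "\<exists>B. \<forall>h\<in>range \<phi>. \<forall>z\<in>K. norm (h z) \<le> B" if "K \<subseteq> ball 0 r" for K
      using n\<phi> that by (intro exI[of _ \<rho>]) auto
  qed (use hol\<phi> in auto)
  have a0: "a j 0 = 0" and da: "(a j has_field_derivative 1) (at 0)" for j
    using iterates_derivative_at_fixpoint[OF der f0, of j] c0
    unfolding a_def by (auto intro!: derivative_eq_intros)
  have d\<phi>: "deriv (\<phi> n) 0 = 1" for n
  proof (rule DERIV_imp_deriv)
    have "((\<lambda>z. (\<Sum>j\<le>n. a j z) / of_nat (Suc n)) has_field_derivative (\<Sum>j\<le>n. 1) / of_nat (Suc n)) (at 0)"
      by (intro DERIV_cdivide DERIV_sum da)
    moreover have "(\<Sum>j\<le>n. 1 :: complex) / of_nat (Suc n) = 1" by (simp del: of_nat_Suc)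
    ultimately show "(\<phi> n has_field_derivative 1) (at 0)" by (simp only: \<phi>_def)
  qed
  have g0: "g 0 = 0"
    using g(3)[of 0] r by (simp add: \<phi>_def a0 LIMSEQ_const_iff)
  have "(\<lambda>n. (deriv ^^ 1) ((\<phi> \<circ> s) n) 0) \<longlonglongrightarrow> (deriv ^^ 1) g 0"
  proof (rule higher_deriv_complex_uniform_limit)
    show "uniform_limit (ball 0 (r/2)) (\<phi> \<circ> s) g sequentially"
      by (rule uniform_limit_on_subset[OF g(4)[of "cball 0 (r/2)"]]) (use r in auto)
    show "\<forall>\<^sub>F n in sequentially. (\<phi> \<circ> s) n holomorphic_on ball 0 (r/2)"
      using r by (intro always_eventually allI) (auto intro!: holomorphic_on_subset[OF hol\<phi>])
  qed (use r in auto)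
  then have dg: "deriv g 0 = 1" by (simp add: d\<phi> LIMSEQ_const_iff)
  have "0 \<in> ball (0::complex) r" "deriv g 0 \<noteq> 0" using dg r by auto
  then obtain e where e: "e > 0" "ball (0::complex) e \<subseteq> ball 0 r" "inj_on g (ball 0 e)"
    by (rule has_complex_derivative_locally_injective[OF g(1) _ open_ball]) fast
  have tend: "(f \<longlongrightarrow> 0) (nhds 0)"
    using DERIV_isCont[OF der] f0 by (simp add: continuous_at tendsto_nhds_iff)
  have ev: "\<forall>\<^sub>F w in nhds 0. f w \<in> ball 0 e \<and> w \<in> ball 0 e"
    using topological_tendstoD[OF tend, of "ball 0 e"] e(1)
    by (intro eventually_conj eventually_nhds_in_open) auto
  have eq: "g (f w) = c * g w" if w: "w \<in> ball 0 e" "f w \<in> ball 0 e" for w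
  proof (rule LIMSEQ_unique)
    have wr: "w \<in> ball 0 r" "f w \<in> ball 0 r" using w e(2) by auto
    show "(\<lambda>n. \<phi> (s n) (f w)) \<longlonglongrightarrow> g (f w)" by (rule g(3)) fact
    \<comment> \<open>Composition with \<open>f\<close> shifts the averaged terms by one index. The
      two boundary terms are bounded, so their quotient by \<open>Suc n\<close> vanishes in the
      limit.\<close>
    have \<phi>f: "\<phi> n (f w) = c * \<phi> n w + c * (a (Suc n) w - w) / of_nat (Suc n)" for n
    proof -
      have "a j (f w) = c * a (Suc j) w" for j
        using c0 by (simp add: a_def funpow_swap1)
      then have "(\<Sum>j\<le>n. a j (f w)) = c * (\<Sum>j\<le>n. a (Suc j) w)"
        by (simp add: sum_distrib_left)
      also have "(\<Sum>j\<le>n. a (Suc j) w) = (\<Sum>j\<le>n. a j w) + a (Suc n) w - w"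
        using sum.atMost_Suc_shift[of "\<lambda>j. a j w" n] by (simp add: a_def algebra_simps)
      finally have "(\<Sum>j\<le>n. a j (f w)) = c * (\<Sum>j\<le>n. a j w) + c * (a (Suc n) w - w)"
        by (simp add: algebra_simps)
      then show ?thesis by (simp add: \<phi>_def add_divide_distrib del: of_nat_Suc)
    qed
    have "(\<lambda>n. c * (a (Suc n) w - w) / of_nat (Suc n)) \<longlonglongrightarrow> 0"
    proof (rule Lim_null_comparison)
      show "\<forall>\<^sub>F n in sequentially. norm (c * (a (Suc n) w - w) / of_nat (Suc n)) \<le> (\<rho> + norm w) * (1 / real (Suc n))"
      proof (intro always_eventually allI)
        fix n
        have "norm (a (Suc n) w - w) \<le> \<rho> + norm w"
          using na[OF wr(1), of "Suc n"] norm_triangle_ineq4[of "a (Suc n) w" w] by linarith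
        then show "norm (c * (a (Suc n) w - w) / of_nat (Suc n)) \<le> (\<rho> + norm w) * (1 / real (Suc n))"
          by (simp add: norm_divide norm_mult c divide_right_mono del: of_nat_Suc)
      qed
      show "(\<lambda>n. (\<rho> + norm w) * (1 / real (Suc n))) \<longlonglongrightarrow> 0"
        using tendsto_mult_left[OF LIMSEQ_inverse_real_of_nat, of "\<rho> + norm w"]
        by (simp add: inverse_eq_divide del: of_nat_Suc)
    qed
    then have "((\<lambda>n. c * (a (Suc n) w - w) / of_nat (Suc n)) \<circ> s) \<longlonglongrightarrow> 0"
      by (rule LIMSEQ_subseq_LIMSEQ) (rule g(2))
    from tendsto_add[OF tendsto_mult_left[OF g(3)[OF wr(1)], of c] this]
    show "(\<lambda>n. \<phi> (s n) (f w)) \<longlonglongrightarrow> c * g w"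
      by (simp add: \<phi>f comp_def del: of_nat_Suc)
  qed
  have "\<forall>\<^sub>F w in nhds 0. f w \<in> ball 0 e \<and> g (f w) = c * g w"
    using ev by eventually_elim (use eq in auto)
  then show ?thesis
    using e g(1) g0 holomorphic_on_subset by (intro exI[of _ "ball 0 e"] exI[of _ g]) auto
qed

text \<open>If an iterate left the disc of radius \<open>\<rho>\<close> for the first time, the circle of radius \<open>s\<close> would be
  mapped away from \<open>0\<close> as a whole, whereas the derivative at \<open>0\<close> has modulus one.\<close>

lemma iterates_trapped:
  fixes f :: "complex \<Rightarrow> complex"
  assumes hol: "f holomorphic_on ball 0 \<rho>" and f0: "f 0 = 0"
    and der: "(f has_field_derivative c) (at 0)" and c: "norm c = 1"
    and nz: "\<And>z. z \<in> ball 0 \<rho> \<Longrightarrow> f z = 0 \<Longrightarrow> z = 0"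
    and bd: "\<And>z. z \<in> ball 0 \<rho> \<Longrightarrow> norm (f z) \<le> 2 * \<rho>"
    and s: "0 < s" "s < \<rho>"
    and uf: "\<And>k z. norm z = s \<Longrightarrow> \<forall>j<k. (f ^^ j) z \<in> ball 0 \<rho> \<Longrightarrow>
          u k z = \<kappa> * ((f ^^ k) z - b) / (f ^^ k) z"
    and b: "4 * \<rho> \<le> norm b" and \<kappa>: "\<kappa> \<noteq> 0"
    and B': "0 < B'" "\<And>k z w. norm z = s \<Longrightarrow> norm w = s \<Longrightarrow>
          norm (u k z) \<le> norm \<kappa> * (2 * \<rho> + norm b) / \<rho> \<Longrightarrow> norm (u k w) \<le> B'"
    and small: "s < 2 * \<rho> * norm \<kappa> / B'"
    and z: "norm z \<le> s"
  shows "(f ^^ k) z \<in> ball 0 \<rho>"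
  using z
proof (induction k arbitrary: z rule: less_induct)
  case (less k)
  show ?case
  proof (rule ccontr)
    assume out: "(f ^^ k) z \<notin> ball 0 \<rho>"
    have \<rho>: "0 < \<rho>" using s by simp
    define h where "h = f ^^ k"
    have inb: "(f ^^ j) w \<in> ball 0 \<rho>" if "j < k" "w \<in> cball 0 s" for j w
      using less.IH that by auto
    have holh: "h holomorphic_on cball 0 s"
      unfolding h_def by (rule iterates_holomorphic[OF hol inb])
    have conth: "continuous_on (cball 0 s) h"
      using holh by (rule holomorphic_on_imp_continuous_on)
    \<comment> \<open>The factor 2 is lost in the last step alone: the preceding iterate, if any, is
      still in the disc of radius \<rho>.\<close>
    have hb: "norm (h w) \<le> 2 * \<rho>" if "w \<in> cball 0 s" for w
    proof (cases k)
      case 0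
      then show ?thesis using that s by (simp add: h_def)
    next
      case (Suc k')
      then show ?thesis using bd[OF inb[of k' w]] that by (simp add: h_def)
    qed
    have hnz: "w = 0" if "h w = 0" "w \<in> cball 0 s" for w
    proof -
      have "(f ^^ j) w = 0 \<Longrightarrow> w = 0" if "j \<le> k" for j
        using that
      proof (induction j)
        case (Suc j)
        then show ?case using nz[OF inb[of j w]] \<open>w \<in> cball 0 s\<close> by simp
      qed simp
      then show ?thesis using that(1) by (auto simp: h_def)
    qed
    have h0: "h 0 = 0" and dh: "(h has_field_derivative c ^ k) (at 0)"
      using iterates_derivative_at_fixpoint[OF der f0, of k] by (auto simp: h_def)
    \<comment> \<open>By the maximum principle, escape at a point of the disc forces escape at a
      point of the circle, where Schottky's bound is available.\<close>
    obtain z1 where z1: "norm z1 = s" "\<rho> \<le> norm (h z1)"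
    proof -
      have "\<exists>z1\<in>sphere 0 s. \<forall>w\<in>sphere 0 s. norm (h w) \<le> norm (h z1)"
        using s(1) by (intro continuous_attains_sup continuous_intros continuous_on_subset[OF conth]) auto
      then obtain z1 where z1: "z1 \<in> sphere 0 s" "\<And>w. w \<in> sphere 0 s \<Longrightarrow> norm (h w) \<le> norm (h z1)"
        by blast
      have "norm (h z) \<le> norm (h z1)"
      proof (rule maximum_modulus_frontier[of h "cball 0 s"])
        show "h holomorphic_on interior (cball 0 s)"
          using holh by (rule holomorphic_on_subset) auto
      qed (use conth z1 less.prems s in auto)
      then have "\<rho> \<le> norm (h z1)" using out by (simp add: h_def)
      then show ?thesis using that z1(1) by simp
    qed
    have uh: "u k w = \<kappa> * (h w - b) / h w" if "norm w = s" for w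
      using uf[OF that] inb that by (simp add: h_def)
    have "norm (u k z1) \<le> norm \<kappa> * (2 * \<rho> + norm b) / \<rho>"
    proof -
      have "norm (h z1 - b) \<le> 2 * \<rho> + norm b"
        using hb[of z1] z1 norm_triangle_ineq4[of "h z1" b] by simp
      then show ?thesis
        unfolding uh[OF z1(1)] norm_mult norm_divide
        using z1 \<rho> by (intro frac_le mult_left_mono mult_nonneg_nonneg) auto
    qed
    then have uw: "norm (u k w) \<le> B'" if "norm w = s" for w
      using B'(2)[OF z1(1) that] by blast
    \<comment> \<open>On the circle \<open>norm (h w - b)\<close> is at least
      \<open>2 * \<rho>\<close>, so the bound \<open>B'\<close> for \<open>u k w\<close> keeps
      \<open>norm (h w)\<close> at least \<sigma>.\<close>
    define \<sigma> where "\<sigma> = 2 * \<rho> * norm \<kappa> / B'"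
    have \<sigma>: "0 < \<sigma>" "s < \<sigma>" using small \<rho> \<kappa> B'(1) by (auto simp: \<sigma>_def)
    have hw: "\<sigma> \<le> norm (h w)" if "norm w = s" for w
    proof -
      have "h w \<noteq> 0" using hnz[of w] that s by auto
      have "4 * \<rho> - 2 * \<rho> \<le> norm (h w - b)"
        using hb[of w] that b norm_triangle_ineq3[of "h w" b] by simp
      then have "norm \<kappa> * (2 * \<rho>) \<le> norm \<kappa> * norm (h w - b)"
        by (intro mult_left_mono) auto
      also have "\<dots> \<le> B' * norm (h w)"
        using uw[OF that] \<open>h w \<noteq> 0\<close>
        unfolding uh[OF that] norm_mult norm_divide by (simp add: pos_divide_le_eq)
      finally show ?thesis using B'(1) by (simp add: \<sigma>_def field_simps)
    qed
    \<comment> \<open>\<open>h w / w\<close> with the singularity at 0 removed. It has no zero in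
      the disc, so the maximum principle applies to its reciprocal and gives
      \<open>1 \<le> s / \<sigma>\<close>, against \<open>s < \<sigma>\<close>.\<close>
    define H where "H = (\<lambda>w. if w = 0 then deriv h 0 else (h w - h 0) / (w - 0))"
    have holH: "H holomorphic_on cball 0 s"
      unfolding H_def by (rule pole_lemma[OF holh]) (use s in auto)
    have dh0: "norm (deriv h 0) = 1"
      using DERIV_imp_deriv[OF dh] c by (simp add: norm_power)
    have Hnz: "H w \<noteq> 0" if "w \<in> cball 0 s" for w
      using hnz[of w] that dh0 by (auto simp: H_def h0)
    have hol1: "(\<lambda>w. 1 / H w) holomorphic_on cball 0 s"
      using holH Hnz by (intro holomorphic_intros) auto
    have "norm (1 / H 0) \<le> s / \<sigma>"
    proof (rule maximum_modulus_frontier[of "\<lambda>w. 1 / H w" "cball 0 s"])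
      show "(\<lambda>w. 1 / H w) holomorphic_on interior (cball 0 s)"
        using hol1 by (rule holomorphic_on_subset) auto
      show "continuous_on (closure (cball 0 s)) (\<lambda>w. 1 / H w)"
        using holomorphic_on_imp_continuous_on[OF hol1] by simp
      show "norm (1 / H w) \<le> s / \<sigma>" if "w \<in> frontier (cball 0 s)" for w
      proof -
        have w: "norm w = s" using that s by simp
        then have "w \<noteq> 0" using s by auto
        then have "norm (1 / H w) = s / norm (h w)" using w by (simp add: H_def h0 norm_divide)
        also have "\<dots> \<le> s / \<sigma>" using hw[OF w] \<sigma> s by (intro divide_left_mono mult_pos_pos) auto
        finally show ?thesis .
      qed
    qed (use s in auto)
    then show False using dh0 \<sigma> s by (simp add: H_def norm_divide field_simps)
  qed
qed

text \<open>Here \<open>g\<close> is an inverse branch, so that \<open>inv\<close> expresses forward invariance of \<open>\<Omega>\<close>: near \<open>0\<close> some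
  \<open>g\<^sup>n\<close> rotates a given point of the annulus into the hole.\<close>

lemma holes_to_annulus:
  fixes g :: "complex \<Rightarrow> complex"
  assumes \<alpha>: "\<alpha> \<notin> \<rat>"
    and der: "(g has_field_derivative exp (2 * of_real pi * \<i> * of_real \<alpha>)) (at 0)" and g0: "g 0 = 0"
    and inv: "\<forall>\<^sub>F w in nhds 0. g w \<in> \<Omega> \<longrightarrow> w \<in> \<Omega>" and "0 \<notin> \<Omega>"
    and c: "0 < c" "c \<le> 1" and "0 < R0"
    and holes: "\<And>R. 0 < R \<Longrightarrow> R < R0 \<Longrightarrow> \<exists>z. ball z (c * R) \<subseteq> \<Omega> \<inter> ball 0 R"
    and "0 < \<sigma>"
  shows "\<exists>s. 0 < s \<and> s < \<sigma> \<and> {w. \<bar>norm w - s\<bar> < c / 2 * s} \<subseteq> \<Omega>"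
proof -
  define \<mu> where "\<mu> = exp (2 * of_real pi * \<i> * complex_of_real \<alpha>)"
  have n\<mu>: "norm \<mu> = 1" by (simp add: \<mu>_def)
  note der' = der[folded \<mu>_def]
  have gd: "((g ^^ n) has_field_derivative \<mu> ^ n) (at 0)" "(g ^^ n) 0 = 0" for n
    using iterates_derivative_at_fixpoint[OF der' g0, of n] by auto
  have inv_n: "\<forall>\<^sub>F w in nhds 0. (g ^^ n) w \<in> \<Omega> \<longrightarrow> w \<in> \<Omega>" for n
  proof (induction n)
    case (Suc n)
    have "((g ^^ n) \<longlongrightarrow> 0) (nhds 0)"
      using DERIV_isCont[OF gd(1)[of n]] gd(2)[of n] by (simp add: continuous_at tendsto_nhds_iff)
    then have "\<forall>\<^sub>F w in nhds 0. g ((g ^^ n) w) \<in> \<Omega> \<longrightarrow> (g ^^ n) w \<in> \<Omega>"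
      using inv by (auto simp: filterlim_iff)
    with Suc show ?case by eventually_elim auto
  qed simp
  obtain N where N: "\<And>\<zeta>. norm \<zeta> = 1 \<Longrightarrow> \<exists>n\<le>N. norm (\<mu> ^ n - \<zeta>) < c / 8"
    using rotation_dense[OF \<alpha>, of "c/8"] c by (auto simp: \<mu>_def)
  have approx: "\<forall>\<^sub>F w in nhds 0. norm ((g ^^ n) w - \<mu> ^ n * w) \<le> c / 8 * norm w" for n
  proof -
    have "((g ^^ n) has_derivative (\<lambda>w. \<mu> ^ n * w)) (at 0)"
      using gd(1)[of n] by (simp add: has_field_derivative_def)
    then obtain d where "d > 0" "\<And>w. norm (w - 0) < d \<Longrightarrow>
        norm ((g ^^ n) w - (g ^^ n) 0 - \<mu> ^ n * (w - 0)) \<le> c / 8 * norm (w - 0)"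
      unfolding has_derivative_at_alt using c by (metis divide_pos_pos zero_less_numeral)
    then show ?thesis unfolding eventually_nhds_metric by (auto simp: gd(2) dist_norm)
  qed
  have "\<forall>\<^sub>F w in nhds 0. \<forall>n\<in>{..N}. ((g ^^ n) w \<in> \<Omega> \<longrightarrow> w \<in> \<Omega>) \<and>
      norm ((g ^^ n) w - \<mu> ^ n * w) \<le> c / 8 * norm w"
    using inv_n approx by (intro eventually_ball_finite ballI eventually_conj) auto
  then obtain d where d: "d > 0" "\<And>w n. norm w < d \<Longrightarrow> n \<le> N \<Longrightarrow> (g ^^ n) w \<in> \<Omega> \<Longrightarrow> w \<in> \<Omega>"
    "\<And>w n. norm w < d \<Longrightarrow> n \<le> N \<Longrightarrow> norm ((g ^^ n) w - \<mu> ^ n * w) \<le> c / 8 * norm w"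
    unfolding eventually_nhds_metric by (auto simp: dist_norm)
  \<comment> \<open>Points of the annulus have modulus below \<open>2 * R \<le> d\<close>, so the
    estimates for all \<open>g ^^ n\<close> with \<open>n \<le> N\<close> hold on it.\<close>
  define R where "R = min (R0 / 2) (min (d / 2) \<sigma>)"
  have R: "0 < R" "R < R0" "R \<le> d / 2" "R \<le> \<sigma>"
    using d(1) \<open>0 < R0\<close> \<open>0 < \<sigma>\<close> by (auto simp: R_def)
  obtain z where z: "ball z (c * R) \<subseteq> \<Omega> \<inter> ball 0 R" using holes R by blast
  have "z \<in> ball z (c * R)" using R c by simp
  then have "z \<in> \<Omega> \<inter> ball 0 R" using z by blast
  then have z': "z \<in> \<Omega>" "norm z < R" by auto
  define s where "s = norm z"
  have s: "0 < s" using z' \<open>0 \<notin> \<Omega>\<close> by (auto simp: s_def)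
  have "w \<in> \<Omega>" if w: "\<bar>norm w - s\<bar> < c / 2 * s" for w
  proof -
    have "c / 2 * s \<le> 1 / 2 * s" using c s by (intro mult_right_mono) auto
    then have w2: "norm w < 2 * s" "0 < norm w" using w s by linarith+
    have w0: "w \<noteq> 0" using w2 by auto
    \<comment> \<open>The rotation taking the direction of \<open>w\<close> to that of
      \<open>z\<close>; some \<open>\<mu> ^ n\<close> is within \<open>c / 8\<close> of it.\<close>
    define \<zeta> where "\<zeta> = (z / of_real s) / (w / of_real (norm w))"
    have "norm \<zeta> = 1" using w0 s by (simp add: \<zeta>_def norm_divide norm_mult s_def)
    then obtain n where n: "n \<le> N" "norm (\<mu> ^ n - \<zeta>) < c / 8" using N by blast
    have wd: "norm w < d" using w2 z' R by (simp add: s_def)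
    have "\<zeta> * w = of_real (norm w / s) * z" using w0 s by (simp add: \<zeta>_def field_simps)
    then have e1: "norm (\<zeta> * w - z) = \<bar>norm w - s\<bar>"
    proof -
      have "\<zeta> * w - z = of_real ((norm w - s) / s) * z"
        using \<open>\<zeta> * w = _\<close> s by (simp add: field_simps)
      then have "norm (\<zeta> * w - z) = \<bar>(norm w - s) / s\<bar> * s"
        by (simp only: norm_mult norm_of_real s_def)
      then show ?thesis using s by (simp add: abs_divide)
    qed
    have e2: "norm (\<mu> ^ n * w - \<zeta> * w) \<le> c / 8 * norm w"
      using mult_right_mono[OF less_imp_le[OF n(2)], of "norm w"]
      by (simp only: norm_mult norm_ge_zero flip: left_diff_distrib)
    have e3: "norm ((g ^^ n) w - \<mu> ^ n * w) \<le> c / 8 * norm w" using d(3)[OF wd n(1)] .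
    \<comment> \<open>As \<open>norm w < 2 * s\<close>, the linearisation error and the rotation
      error are at most \<open>c * s / 4\<close> each, and the radial error is below
      \<open>c * s / 2\<close>; the total stays below the radius \<open>c * R\<close> of the
      hole.\<close>
    have "norm ((g ^^ n) w - z) \<le> norm ((g ^^ n) w - \<mu> ^ n * w) + norm (\<mu> ^ n * w - \<zeta> * w) + norm (\<zeta> * w - z)"
      by (smt (verit) norm_triangle_ineq diff_add_cancel add_diff_eq)
    also have "\<dots> < c / 8 * norm w + c / 8 * norm w + c / 2 * s"
      using e1 e2 e3 w by linarith
    also have "\<dots> \<le> c / 8 * (2 * s) + c / 8 * (2 * s) + c / 2 * s"
      using w2 c by (intro add_mono mult_left_mono) auto
    also have "\<dots> = c * s" by simp
    also have "\<dots> \<le> c * R" using z' c by (simp add: s_def)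
    finally have "(g ^^ n) w \<in> ball z (c * R)" by (simp add: dist_norm norm_minus_commute)
    then show ?thesis using z d(2)[OF wd n(1)] by auto
  qed
  moreover have "s < \<sigma>" using z' R by (simp add: s_def)
  ultimately show ?thesis using s by blast
qed

section \<open>Iteration of rational maps\<close>

text \<open>The binary form of degree \<open>d\<close> attached to \<open>p\<close>. The forms of
  \<open>p\<close> and \<open>q\<close> together lift the rational map to pairs of coordinates,
  where infinity is not special.\<close>

definition homogenized :: "nat \<Rightarrow> complex poly \<Rightarrow> complex \<Rightarrow> complex \<Rightarrow> complex" where
  "homogenized d p X Y = (\<Sum>i\<le>d. coeff p i * X ^ i * Y ^ (d - i))"

lemma homogenized_nonzero:
  assumes "degree p \<le> d" "Y \<noteq> 0"
  shows "homogenized d p X Y = Y ^ d * poly p (X / Y)"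
proof -
  have "poly p (X / Y) = (\<Sum>i\<le>d. coeff p i * (X / Y) ^ i)"
    unfolding poly_altdef using assms(1)
    by (intro sum.mono_neutral_left) (auto simp: coeff_eq_0)
  then have "Y ^ d * poly p (X / Y) = (\<Sum>i\<le>d. Y ^ d * (coeff p i * (X / Y) ^ i))"
    by (simp add: sum_distrib_left)
  also have "\<dots> = homogenized d p X Y"
    unfolding homogenized_def
  proof (rule sum.cong)
    fix i assume "i \<in> {..d}"
    then have "Y ^ d = Y ^ (d - i) * Y ^ i" by (simp flip: power_add)
    then show "Y ^ d * (coeff p i * (X / Y) ^ i) = coeff p i * X ^ i * Y ^ (d - i)"
      using assms(2) by (simp add: power_divide)
  qed simp
  finally show ?thesis ..
qed

lemma homogenized_zero: "homogenized d p X 0 = coeff p d * X ^ d"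
proof -
  have "homogenized d p X 0 = (\<Sum>i\<in>{d}. coeff p i * X ^ i * 0 ^ (d - i))"
    unfolding homogenized_def by (rule sum.mono_neutral_right) auto
  then show ?thesis by simp
qed

definition homogeneous_point :: "complex \<Rightarrow> complex \<Rightarrow> sphere" where
  "homogeneous_point X Y = (if Y = 0 then None else Some (X / Y))"

text \<open>An orbit that meets a periodic point runs through a single cycle from then on, so it is
  a finite set.\<close>

lemma finite_periodic_points_in_orbit:
  "finite {x. (\<exists>n. (f ^^ n) s = x) \<and> (\<exists>m>0. (f ^^ m) x = x)}" (is "finite ?A")
proof (cases "?A = {}")
  case False
  then obtain k m where k: "m > 0" "(f ^^ m) ((f ^^ k) s) = (f ^^ k) s" by auto
  have "?A \<subseteq> (\<lambda>n. (f ^^ n) s) ` {..<k + m}"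
  proof
    fix x assume "x \<in> ?A"
    then obtain n where n: "(f ^^ n) s = x" by auto
    show "x \<in> (\<lambda>n. (f ^^ n) s) ` {..<k + m}"
    proof (cases "n < k")
      case False
      then have "x = (f ^^ (n - k)) ((f ^^ k) s)"
        using n by (simp flip: funpow_add[THEN fun_cong, unfolded comp_def])
      also have "\<dots> = (f ^^ ((n - k) mod m)) ((f ^^ k) s)"
        using funpow_mod_eq[OF k(2)] by simp
      also have "\<dots> = (f ^^ ((n - k) mod m + k)) s" by (simp add: funpow_add)
      finally show ?thesis using k(1) by (intro image_eqI[of _ _ "(n - k) mod m + k"]) auto
    qed (use n in auto)
  qed
  then show ?thesis by (rule finite_subset) simp
qed (simp only: finite.emptyI)

locale rational_dynamics =
  fixes p q :: "complex poly" and d :: nat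
  assumes cop: "coprime p q" and deg: "max (degree p) (degree q) = d" and d2: "2 \<le> d"
begin

abbreviation "T \<equiv> rational_fun p q"
abbreviation "f \<equiv> (\<lambda>z. poly p z / poly q z)"

lemma degree_le: "degree p \<le> d" "degree q \<le> d"
  using deg by auto

lemma no_common_root: "poly p z = 0 \<Longrightarrow> poly q z \<noteq> 0"
  using coprime_poly_0[OF cop] by auto

lemma leading_coeffs: "coeff p d \<noteq> 0 \<or> coeff q d \<noteq> 0"
proof (cases "degree p = d")
  case True
  then show ?thesis using d2 by auto
next
  case False
  then have "degree q = d" using deg by auto
  then show ?thesis using d2 by auto
qed

lemma T_Some: "T (Some z) = (if poly q z = 0 then None else Some (f z))"
  by (simp add: rational_fun_def)

text \<open>The lifted pair never vanishes: at finite points by coprimality, at infinity because one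
  of the polynomials has degree exactly \<open>d\<close>. Hence the lift can be iterated.\<close>

lemma T_homogeneous:
  assumes "X \<noteq> 0 \<or> Y \<noteq> 0"
  shows "T (homogeneous_point X Y) = homogeneous_point (homogenized d p X Y) (homogenized d q X Y)"
    and "homogenized d p X Y \<noteq> 0 \<or> homogenized d q X Y \<noteq> 0"
proof -
  consider "Y \<noteq> 0" | "Y = 0" "X \<noteq> 0" using assms by auto
  then have "T (homogeneous_point X Y) = homogeneous_point (homogenized d p X Y) (homogenized d q X Y)
      \<and> (homogenized d p X Y \<noteq> 0 \<or> homogenized d q X Y \<noteq> 0)"
  proof cases
    case 1
    then show ?thesis using no_common_root[of "X/Y"]
      by (auto simp: homogeneous_point_def homogenized_nonzero degree_le T_Some)
  next
    case 2
    then show ?thesis using leading_coeffs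
      by (auto simp: homogeneous_point_def homogenized_zero rational_fun_def deg Let_def)
  qed
  then show "T (homogeneous_point X Y) = homogeneous_point (homogenized d p X Y) (homogenized d q X Y)"
    and "homogenized d p X Y \<noteq> 0 \<or> homogenized d q X Y \<noteq> 0" by auto
qed

text \<open>Homogeneous coordinates of \<open>T\<^sup>n z\<close>; being entire in \<open>z\<close>, they avoid any case
  distinction for orbits through infinity.\<close>

primrec iter :: "nat \<Rightarrow> complex \<Rightarrow> complex \<times> complex" where
  "iter 0 z = (z, 1)"
| "iter (Suc n) z = (homogenized d p (fst (iter n z)) (snd (iter n z)),
                     homogenized d q (fst (iter n z)) (snd (iter n z)))"

definition num :: "nat \<Rightarrow> complex \<Rightarrow> complex" where "num n z = fst (iter n z)"
definition den :: "nat \<Rightarrow> complex \<Rightarrow> complex" where "den n z = snd (iter n z)"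
definition val :: "nat \<Rightarrow> complex \<Rightarrow> complex" where "val n z = num n z / den n z"

lemma holomorphic_num_den: "num n holomorphic_on A" "den n holomorphic_on A"
proof -
  have "num n holomorphic_on A \<and> den n holomorphic_on A"
  proof (induction n)
    case 0
    then show ?case by (auto simp: num_def[abs_def] den_def[abs_def])
  next
    case (Suc n)
    then show ?case
      by (auto simp: num_def[abs_def] den_def[abs_def] homogenized_def intro!: holomorphic_intros)
  qed
  then show "num n holomorphic_on A" "den n holomorphic_on A" by auto
qed

lemma T_pow_homogeneous:
  "(T ^^ n) (Some z) = homogeneous_point (num n z) (den n z)" "num n z \<noteq> 0 \<or> den n z \<noteq> 0"
proof -
  have "(T ^^ n) (Some z) = homogeneous_point (num n z) (den n z) \<and> (num n z \<noteq> 0 \<or> den n z \<noteq> 0)"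
  proof (induction n)
    case 0
    then show ?case by (simp add: num_def den_def homogeneous_point_def)
  next
    case (Suc n)
    then show ?case using T_homogeneous[of "num n z" "den n z"]
      by (simp add: num_def den_def)
  qed
  then show "(T ^^ n) (Some z) = homogeneous_point (num n z) (den n z)"
    "num n z \<noteq> 0 \<or> den n z \<noteq> 0" by auto
qed

lemma T_pow_eq_Some_iff: "(T ^^ n) (Some z) = Some w \<longleftrightarrow> den n z \<noteq> 0 \<and> val n z = w"
  by (simp add: T_pow_homogeneous(1) homogeneous_point_def val_def)

text \<open>The cross-multiplied equation is right at poles of the iterate too: there
  \<open>den n z\<close> vanishes and \<open>num n z\<close> does not, so the equation
  fails.\<close>

lemma T_pow_eq_Some_iff': "(T ^^ n) (Some z) = Some w \<longleftrightarrow> num n z = w * den n z"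
  using T_pow_homogeneous(2)[of n z] by (auto simp: T_pow_eq_Some_iff val_def field_simps)

lemma eventually_den_nonzero:
  assumes "den n z \<noteq> 0" shows "\<forall>\<^sub>F w in nhds z. den n w \<noteq> 0"
proof -
  have "isCont (den n) z"
    using holomorphic_on_imp_continuous_on[OF holomorphic_num_den(2)[of n UNIV]]
    by (simp add: continuous_on_eq_continuous_at)
  then show ?thesis using assms
    using tendsto_imp_eventually_ne[of "den n" "den n z" "nhds z" 0]
    by (simp add: continuous_at tendsto_nhds_iff)
qed

lemma val_derivative:
  assumes "den n z \<noteq> 0" shows "(val n has_field_derivative deriv (val n) z) (at z)"
proof -
  have "(num n has_field_derivative deriv (num n) z) (at z)"
    "(den n has_field_derivative deriv (den n) z) (at z)"
    using holomorphic_num_den[of n UNIV] holomorphic_derivI by (metis UNIV_I open_UNIV)+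
  from DERIV_divide[OF this assms] show ?thesis
    unfolding val_def[abs_def] by (simp add: DERIV_imp_deriv)
qed

lemma multiplier_pow:
  assumes "(T ^^ n) (Some z) = Some z"
  shows "multiplier (T ^^ n) (Some z) = deriv (val n) z"
proof (rule multiplier_Some[where T = "T ^^ n", OF assms])
  have "den n z \<noteq> 0" using assms by (simp add: T_pow_eq_Some_iff)
  then show "\<forall>\<^sub>F w in nhds z. (T ^^ n) (Some w) = Some (val n w)"
    by (intro eventually_mono[OF eventually_den_nonzero] T_pow_eq_Some_iff[THEN iffD2]) auto
qed

text \<open>\<Phi> is a local inverse of the iterate, so by the chain rule the multiplier is the
  reciprocal of \<open>D\<close>.\<close>

lemma repelling_periodic_pointI:
  assumes "0 < n" "\<forall>\<^sub>F u in nhds v. (T ^^ n) (Some (\<Phi> u)) = Some u" "\<Phi> v = v"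
    "(\<Phi> has_field_derivative D) (at v)" "norm D < 1"
  shows "repelling_periodic_point T (Some v)"
proof -
  have fx: "(T ^^ n) (Some v) = Some v"
    using eventually_nhds_x_imp_x[OF assms(2)] assms(3) by simp
  then have dv: "den n v \<noteq> 0" by (simp add: T_pow_eq_Some_iff)
  have "((\<lambda>u. val n (\<Phi> u)) has_field_derivative deriv (val n) v * D) (at v)"
    by (rule DERIV_chain2[where f = "val n" and g = \<Phi>])
      (use val_derivative[OF dv] assms(3,4) in auto)
  moreover have "\<forall>\<^sub>F u in nhds v. val n (\<Phi> u) = u"
    using assms(2) by eventually_elim (simp add: T_pow_eq_Some_iff)
  ultimately have "((\<lambda>u. u) has_field_derivative deriv (val n) v * D) (at v)"
    using DERIV_cong_ev[of v v "\<lambda>u. val n (\<Phi> u)" "\<lambda>u. u"] by auto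
  then have "deriv (val n) v * D = 1" using DERIV_unique DERIV_ident by blast
  then have e: "norm (deriv (val n) v) * norm D = 1" by (metis norm_mult norm_one)
  have "norm (deriv (val n) v) > 1"
  proof (rule ccontr)
    assume "\<not> ?thesis"
    then have "norm (deriv (val n) v) * norm D \<le> 1 * norm D" by (intro mult_right_mono) auto
    with e assms(5) show False by simp
  qed
  then show ?thesis
    unfolding repelling_periodic_point_def using fx assms(1) multiplier_pow[OF fx] by auto
qed

text \<open>The zeros of the Wronskian are the finite critical points. Outside the forward orbits of these and
  of infinity, inverse branches exist along every backward orbit.\<close>

definition wronskian :: "complex poly" where
  "wronskian = pderiv p * q - p * pderiv q"

definition nonexceptional :: "complex \<Rightarrow> bool" where
  "nonexceptional w \<longleftrightarrow> (\<forall>n. (T ^^ n) None \<noteq> Some w) \<and>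
     (\<forall>c n. poly wronskian c = 0 \<longrightarrow> (T ^^ n) (Some c) \<noteq> Some w)"

text \<open>At a root of a nonconstant \<open>p\<close>, which is no root of \<open>q\<close>, the
  order of \<open>pderiv p * q\<close> is one below that of \<open>p\<close>, whereas
  \<open>p * pderiv q\<close> vanishes at least to the order of \<open>p\<close>. If
  \<open>p\<close> is constant, the two are exchanged.\<close>

lemma wronskian_neq_0: "wronskian \<noteq> 0"
proof -
  have *: "pderiv p * q \<noteq> p * pderiv q" if dp: "degree p > 0" and cp: "coprime p q" for p q :: "complex poly"
  proof
    assume eq: "pderiv p * q = p * pderiv q"
    obtain z where z: "poly p z = 0" using alg_closed_imp_poly_has_root[OF dp] by blast
    have qz: "poly q z \<noteq> 0" using coprime_poly_0[OF cp, of z] z by auto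
    have p': "pderiv p \<noteq> 0" "p \<noteq> 0" using dp by (auto simp: pderiv_eq_0_iff)
    have n0: "pderiv p * q \<noteq> 0" using p' qz by auto
    have "order z p = Suc (order z (pderiv p))"
      using order_pderiv[of p z] z p' by (simp add: order_root)
    moreover have "order z (pderiv p * q) = order z (pderiv p) + order z q"
      using n0 by (rule order_mult)
    moreover have "order z (pderiv p * q) = order z p + order z (pderiv q)"
      using n0 order_mult[of p "pderiv q" z] by (simp add: eq)
    moreover have "order z q = 0" using qz by (simp add: order_root)
    ultimately show False by simp
  qed
  have "degree p > 0 \<or> degree q > 0" using deg d2 by auto
  then show ?thesis
    using *[of p q] *[of q p] cop
    by (auto simp: wronskian_def coprime_commute mult.commute)
qed

section \<open>Inverse branches and preimages of nonexceptional points\<close>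

lemma nonexceptional_preimage:
  assumes "nonexceptional w" "(T ^^ n) (Some x) = Some w"
  shows "nonexceptional x"
proof -
  have "(T ^^ (n + k)) y = Some w" if "(T ^^ k) y = Some x" for k y
    using that assms(2) by (simp add: funpow_add)
  then show ?thesis using assms(1) unfolding nonexceptional_def by blast
qed

lemma f_has_field_derivative:
  assumes "poly q x \<noteq> 0"
  shows "(f has_field_derivative poly wronskian x / (poly q x)\<^sup>2) (at x)"
  unfolding wronskian_def using assms
  by (auto intro!: derivative_eq_intros simp: power2_eq_square field_simps)

text \<open>Local inverses of \<open>f\<close> are composed along the orbit from \<open>x\<close> to
  \<open>w\<close>. This orbit meets no pole, since \<open>w\<close> is not on the orbit of
  infinity, and no critical point.\<close>

lemma local_inverse_branch:
  assumes w: "nonexceptional w" and x: "(T ^^ n) (Some x) = Some w"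
  shows "\<exists>V G. open V \<and> w \<in> V \<and> G holomorphic_on V \<and> G w = x \<and>
    (\<forall>v\<in>V. (T ^^ n) (Some (G v)) = Some v)"
  using x
proof (induction n arbitrary: x)
  case 0
  then show ?case by (intro exI[of _ UNIV] exI[of _ id]) (auto simp: id_def)
next
  case (Suc n)
  have q0: "poly q x \<noteq> 0"
  proof
    assume "poly q x = 0"
    then have "(T ^^ n) None = Some w" using Suc.prems by (simp add: funpow_swap1 T_Some)
    then show False using w by (auto simp: nonexceptional_def)
  qed
  then have Tx: "(T ^^ n) (Some (f x)) = Some w"
    using Suc.prems by (simp add: funpow_swap1 T_Some)
  then obtain V G where V: "open V" "w \<in> V" "G holomorphic_on V" "G w = f x"
    "\<forall>v\<in>V. (T ^^ n) (Some (G v)) = Some v"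
    using Suc.IH by blast
  have "poly wronskian x \<noteq> 0" using w Suc.prems unfolding nonexceptional_def by blast
  then have df: "deriv f x \<noteq> 0" using DERIV_imp_deriv[OF f_has_field_derivative[OF q0]] q0 by simp
  have "f holomorphic_on {z. poly q z \<noteq> 0}"
    by (intro holomorphic_intros) auto
  moreover have "open {z. poly q z \<noteq> 0}" "x \<in> {z. poly q z \<noteq> 0}"
    using q0 by (auto intro!: open_Collect_neq continuous_intros)
  ultimately obtain V' g where V': "open V'" "f x \<in> V'" "g holomorphic_on V'"
    "g ` V' \<subseteq> {z. poly q z \<noteq> 0}" "\<And>v. v \<in> V' \<Longrightarrow> f (g v) = v" "g (f x) = x"
    by (rule local_holomorphic_inverse[OF _ _ _ df]) (rule that; assumption)
  show ?case
  proof (intro exI[of _ "V \<inter> G -` V'"] exI[of _ "g \<circ> G"] conjI ballI)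
    show "open (V \<inter> G -` V')"
      using V(1) V'(1) holomorphic_on_imp_continuous_on[OF V(3)] by (simp add: continuous_on_open_vimage Int_commute)
    show "w \<in> V \<inter> G -` V'" using V V' by auto
    show "g \<circ> G holomorphic_on V \<inter> G -` V'"
      by (rule holomorphic_on_compose_gen[OF holomorphic_on_subset[OF V(3)] V'(3)]) auto
    show "(g \<circ> G) w = x" using V V' by simp
    show "(T ^^ Suc n) (Some ((g \<circ> G) v)) = Some v" if "v \<in> V \<inter> G -` V'" for v
    proof -
      have "poly q (g (G v)) \<noteq> 0" using V'(4) that by auto
      then have "T (Some (g (G v))) = Some (G v)" using V'(5) that by (simp add: T_Some)
      then show ?thesis using V(5) that by (simp add: funpow_swap1)
    qed
  qed
qed

text \<open>Infinity is not a preimage of \<open>x\<close>, so \<open>p - smult x q\<close> has full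
  degree \<open>d \<ge> 2\<close>; a double root would be a critical point mapped to
  \<open>x\<close>.\<close>

lemma two_preimages:
  assumes "nonexceptional x"
  obtains x1 x2 where "x1 \<noteq> x2" "T (Some x1) = Some x" "T (Some x2) = Some x"
proof -
  define R where "R = p - smult x q"
  have "coeff R d \<noteq> 0"
  proof
    assume "coeff R d = 0"
    then have e: "coeff p d = x * coeff q d" by (simp add: R_def)
    then have "coeff q d \<noteq> 0" using leading_coeffs by auto
    then have "(T ^^ 1) None = Some x" using e by (simp add: rational_fun_def deg Let_def)
    then show False using assms unfolding nonexceptional_def by blast
  qed
  then have dR: "degree R \<ge> 2" using d2 le_degree[of R d] by simp
  have root: "T (Some z) = Some x" if "poly R z = 0" for z
    using that no_common_root[of z] by (auto simp: R_def T_Some)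
  obtain x1 where x1: "poly R x1 = 0" using alg_closed_imp_poly_has_root[of R] dR by auto
  then obtain S where S: "R = [:- x1, 1:] * S" by (metis dvdE poly_eq_0_iff_dvd)
  have "S \<noteq> 0" using S dR by auto
  then have "degree R = 1 + degree S" unfolding S by (subst degree_mult_eq) auto
  then obtain x2 where x2: "poly S x2 = 0" using alg_closed_imp_poly_has_root[of S] dR by auto
  have "x1 \<noteq> x2"
  proof
    assume "x1 = x2"
    then have "poly (pderiv R) x1 = 0" using x2 by (simp only: S pderiv_mult) (simp add: pderiv_pCons)
    then have "poly (pderiv p) x1 = x * poly (pderiv q) x1" by (simp add: R_def pderiv_diff pderiv_smult)
    moreover have "poly p x1 = x * poly q x1" using x1 by (simp add: R_def)
    ultimately have "poly wronskian x1 = 0" by (simp add: wronskian_def)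
    moreover have "(T ^^ 1) (Some x1) = Some x" using root[OF x1] by simp
    ultimately show False using assms unfolding nonexceptional_def by blast
  qed
  moreover have "poly R x2 = 0" using x2 by (simp add: S)
  ultimately show thesis using that root x1 by blast
qed

end

section \<open>Backward orbits of repelling points\<close>

context rational_dynamics
begin

text \<open>The cross ratio sending \<open>a\<close>, \<open>b\<close>, \<open>c\<close> to \<open>0\<close>, \<open>1\<close>, \<open>\<infinity>\<close>, applied to \<open>T\<^sup>n z\<close>.\<close>

definition cross :: "complex \<Rightarrow> complex \<Rightarrow> complex \<Rightarrow> nat \<Rightarrow> complex \<Rightarrow> complex" where
  "cross a b c n z = (b - c) / (b - a) * ((num n z - a * den n z) / (num n z - c * den n z))"

text \<open>In homogeneous coordinates the cross ratio makes sense also where the iterate is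
  infinite, so only the three finite values have to be omitted.\<close>

lemma cross_omits:
  assumes "a \<noteq> b" "b \<noteq> c" "a \<noteq> c"
    and "(T ^^ n) (Some z) \<noteq> Some a" "(T ^^ n) (Some z) \<noteq> Some b" "(T ^^ n) (Some z) \<noteq> Some c"
  shows "cross a b c n z \<noteq> 0 \<and> cross a b c n z \<noteq> 1"
proof -
  have n: "num n z - a * den n z \<noteq> 0" "num n z - c * den n z \<noteq> 0" "num n z \<noteq> b * den n z"
    using assms(4-) by (auto simp: T_pow_eq_Some_iff')
  have "cross a b c n z \<noteq> 1"
  proof
    assume "cross a b c n z = 1"
    then have "(b - c) * (num n z - a * den n z) = (b - a) * (num n z - c * den n z)"
      using n assms(1) by (simp add: cross_def field_simps)
    then have "(a - c) * (num n z - b * den n z) = 0" by (simp add: algebra_simps)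
    then show False using n assms by simp
  qed
  then show ?thesis using n assms by (simp add: cross_def)
qed

lemma cross_holomorphic:
  assumes "\<And>z. z \<in> A \<Longrightarrow> (T ^^ n) (Some z) \<noteq> Some c"
  shows "cross a b c n holomorphic_on A"
  unfolding cross_def[abs_def] using assms
  by (intro holomorphic_intros holomorphic_num_den) (auto simp: T_pow_eq_Some_iff')

lemma cross_value:
  assumes "(T ^^ n) (Some z) = Some w" "w \<noteq> c"
  shows "cross a b c n z = (b - c) / (b - a) * ((w - a) / (w - c))"
proof -
  have "num n z = w * den n z" "den n z \<noteq> 0"
    using assms by (simp_all add: T_pow_eq_Some_iff' flip: T_pow_eq_Some_iff')
       (use assms in \<open>auto simp: T_pow_eq_Some_iff\<close>)
  then show ?thesis
    by (simp add: cross_def flip: left_diff_distrib)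
qed

text \<open>The derivative at \<open>w\<close> of the inverse branch fixing \<open>w\<close> is the
  reciprocal of the multiplier, so the branch contracts a small disc towards \<open>w\<close> and
  can be iterated there.\<close>

lemma contracting_branch:
  assumes w: "nonexceptional w" and rep: "repelling_periodic_point T (Some w)"
  obtains m \<delta> \<kappa> G where "m > 0" "\<delta> > 0" "0 \<le> \<kappa>" "\<kappa> < 1" "G holomorphic_on ball w \<delta>"
    "\<And>v i. v \<in> ball w \<delta> \<Longrightarrow> (G ^^ i) v \<in> ball w \<delta> \<and> dist ((G ^^ i) v) w \<le> \<kappa> ^ i * dist v w \<and>
      (T ^^ (m * i)) (Some ((G ^^ i) v)) = Some v"
proof -
  obtain m where m: "m > 0" "(T ^^ m) (Some w) = Some w" "norm (multiplier (T ^^ m) (Some w)) > 1"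
    using rep unfolding repelling_periodic_point_def by blast
  obtain V G where V: "open V" "w \<in> V" "G holomorphic_on V" "G w = w"
    "\<And>v. v \<in> V \<Longrightarrow> (T ^^ m) (Some (G v)) = Some v"
    using local_inverse_branch[OF w m(2)] by blast
  have dw: "den m w \<noteq> 0" using m(2) by (simp add: T_pow_eq_Some_iff)
  have dG: "(G has_field_derivative deriv G w) (at w)"
    using holomorphic_derivI[OF V(3,1,2)] .
  have "((\<lambda>v. val m (G v)) has_field_derivative deriv (val m) w * deriv G w) (at w)"
    by (rule DERIV_chain2[where f = "val m" and g = G]) (use val_derivative[OF dw] dG V(4) in auto)
  moreover have "\<forall>\<^sub>F v in nhds w. val m (G v) = v"
    using eventually_nhds_in_open[OF V(1,2)] by eventually_elim (use V(5) T_pow_eq_Some_iff in blast)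
  ultimately have "((\<lambda>v. v) has_field_derivative deriv (val m) w * deriv G w) (at w)"
    using DERIV_cong_ev[of w w "\<lambda>v. val m (G v)" "\<lambda>v. v"] by auto
  then have "deriv (val m) w * deriv G w = 1" using DERIV_unique DERIV_ident by blast
  then have e: "norm (deriv (val m) w) * norm (deriv G w) = 1" by (metis norm_mult norm_one)
  have "norm (deriv (val m) w) > 1" using m(3) multiplier_pow[OF m(2)] by simp
  with e have nG: "norm (deriv G w) < 1"
    by (smt (verit) mult_le_cancel_right1 norm_ge_zero mult_less_cancel_right1)
  define \<kappa> where "\<kappa> = (1 + norm (deriv G w)) / 2"
  have \<kappa>: "norm (deriv G w) < \<kappa>" "0 \<le> \<kappa>" "\<kappa> < 1" using nG by (auto simp: \<kappa>_def)
  have "(G has_derivative (\<lambda>v. deriv G w * v)) (at w)"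
    using dG by (simp add: has_field_derivative_def)
  then obtain \<delta>0 where \<delta>0: "\<delta>0 > 0" "\<And>v. norm (v - w) < \<delta>0 \<Longrightarrow>
      norm (G v - G w - deriv G w * (v - w)) \<le> (\<kappa> - norm (deriv G w)) * norm (v - w)"
    unfolding has_derivative_at_alt using \<kappa>(1) by (metis diff_gt_0_iff_gt)
  obtain \<delta>1 where \<delta>1: "\<delta>1 > 0" "ball w \<delta>1 \<subseteq> V" using V(1,2) open_contains_ball by blast
  define \<delta> where "\<delta> = min \<delta>0 \<delta>1"
  have \<delta>: "\<delta> > 0" "ball w \<delta> \<subseteq> V" using \<delta>0 \<delta>1 by (auto simp: \<delta>_def)
  have contr: "dist (G v) w \<le> \<kappa> * dist v w" if "v \<in> ball w \<delta>" for v
  proof -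
    have "norm (v - w) < \<delta>0" using that by (simp add: \<delta>_def dist_norm norm_minus_commute)
    then have "norm (G v - w - deriv G w * (v - w)) \<le> (\<kappa> - norm (deriv G w)) * norm (v - w)"
      using \<delta>0(2) V(4) by metis
    moreover have "norm (G v - w) \<le> norm (G v - w - deriv G w * (v - w)) + norm (deriv G w * (v - w))"
      by (metis diff_add_cancel norm_triangle_ineq)
    ultimately have "norm (G v - w) \<le> (\<kappa> - norm (deriv G w)) * norm (v - w) + norm (deriv G w) * norm (v - w)"
      unfolding norm_mult by linarith
    then show ?thesis by (simp add: dist_norm flip: distrib_right)
  qed
  have main: "(G ^^ i) v \<in> ball w \<delta> \<and> dist ((G ^^ i) v) w \<le> \<kappa> ^ i * dist v w \<and>
      (T ^^ (m * i)) (Some ((G ^^ i) v)) = Some v" if v: "v \<in> ball w \<delta>" for v i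
  proof (induction i)
    case (Suc i)
    define x where "x = (G ^^ i) v"
    have x: "x \<in> ball w \<delta>" "dist x w \<le> \<kappa> ^ i * dist v w" "(T ^^ (m * i)) (Some x) = Some v"
      using Suc by (auto simp: x_def)
    have "dist (G x) w \<le> \<kappa> * dist x w" using contr x by blast
    also have "\<dots> \<le> \<kappa> * (\<kappa> ^ i * dist v w)" using x \<kappa> by (intro mult_left_mono) auto
    finally have 1: "dist (G x) w \<le> \<kappa> ^ Suc i * dist v w" by (simp add: mult.assoc)
    have "\<kappa> * dist x w \<le> 1 * dist x w" using \<kappa> by (intro mult_right_mono) auto
    then have "dist (G x) w \<le> dist x w" using contr[OF x(1)] by simp
    then have 2: "G x \<in> ball w \<delta>" using x(1) by (simp add: dist_commute)
    have "(T ^^ m) (Some (G x)) = Some x" using V(5) \<delta>(2) x(1) by blast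
    then have "(T ^^ (m * i + m)) (Some (G x)) = Some v" using x(3) by (simp add: funpow_add)
    then have 3: "(T ^^ (m * Suc i)) (Some (G x)) = Some v" by (simp add: add.commute)
    show ?case using 1 2 3 by (simp add: x_def)
  qed (use v in simp)
  show thesis
    by (rule that[OF m(1) \<delta>(1) \<kappa>(2,3) holomorphic_on_subset[OF V(3) \<delta>(2)] main])
qed

text \<open>Otherwise the iterates would omit \<open>x\<close> and its two preimages near \<open>w\<close>, hence be equicontinuous there by
  Schottky's theorem.\<close>

lemma backward_orbit_accumulates:
  assumes w: "nonexceptional w" and rep: "repelling_periodic_point T (Some w)"
    and x: "(T ^^ j) (Some x) = Some w" and \<epsilon>: "0 < \<epsilon>"
  shows "\<exists>y\<in>ball w \<epsilon>. \<exists>l. (T ^^ l) (Some y) = Some x"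
proof (rule ccontr)
  assume "\<not> ?thesis"
  then have hx: "\<And>y l. y \<in> ball w \<epsilon> \<Longrightarrow> (T ^^ l) (Some y) \<noteq> Some x" by blast
  obtain x1 x2 where x12: "x1 \<noteq> x2" "T (Some x1) = Some x" "T (Some x2) = Some x"
    using two_preimages[OF nonexceptional_preimage[OF w x]] .
  have pre: "(T ^^ l) (Some y) \<noteq> Some x'" if "T (Some x') = Some x" "y \<in> ball w \<epsilon>" for x' y l
    using hx[OF that(2), of "Suc l"] that(1) by auto
  \<comment> \<open>If \<open>x\<close> were its own preimage it would be fixed, hence equal to
    \<open>w\<close>, which lies in the disc where \<open>x\<close> is omitted.\<close>
  have ne: "x' \<noteq> x" if "T (Some x') = Some x" for x'
  proof
    assume "x' = x"
    then have "(T ^^ j) (Some x) = Some x" for j using that by (induction j) auto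
    then have "x = w" using x by simp
    then show False using hx[of w 0] \<epsilon> by simp
  qed
  have d: "x \<noteq> x1" "x1 \<noteq> x2" "x \<noteq> x2" using ne x12 by auto
  obtain m \<delta>' \<kappa> G where G: "m > 0" "\<delta>' > 0" "0 \<le> \<kappa>" "\<kappa> < 1" "G holomorphic_on ball w \<delta>'"
    "\<And>v i. v \<in> ball w \<delta>' \<Longrightarrow> (G ^^ i) v \<in> ball w \<delta>' \<and> dist ((G ^^ i) v) w \<le> \<kappa> ^ i * dist v w \<and>
      (T ^^ (m * i)) (Some ((G ^^ i) v)) = Some v"
    by (rule contracting_branch[OF w rep]) (rule that; assumption)
  define \<delta> where "\<delta> = min \<epsilon> \<delta>'"
  have \<delta>: "\<delta> > 0" "ball w \<delta> \<subseteq> ball w \<epsilon>" "ball w \<delta> \<subseteq> ball w \<delta>'" using \<epsilon> G(2) by (auto simp: \<delta>_def)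
  define M where "M = (\<lambda>v. (x1 - x2) / (x1 - x) * ((v - x) / (v - x2)))"
  define u where "u = (\<lambda>i. cross x x1 x2 (m * i))"
  have omit: "(T ^^ n) (Some y) \<noteq> Some x" "(T ^^ n) (Some y) \<noteq> Some x1" "(T ^^ n) (Some y) \<noteq> Some x2"
    if "y \<in> ball w \<delta>" for y n
    using that \<delta>(2) hx pre x12 by blast+
  have holu: "u i holomorphic_on ball w \<delta>" for i
    unfolding u_def by (rule cross_holomorphic) (use omit in auto)
  have avu: "u i z \<noteq> 0 \<and> u i z \<noteq> 1" if "z \<in> ball w \<delta>" for i z
    unfolding u_def by (rule cross_omits[OF d omit[OF that]])
  have ww: "w \<in> ball w \<delta>" using \<delta> by simp
  have Gw: "(G ^^ i) w = w" for i using G(6)[of w i] G(2) by simp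
  have nx2: "v \<noteq> x2" if "v \<in> ball w \<delta>" for v using omit(3)[OF that, of 0] by simp
  \<comment> \<open>\<open>G ^^ i\<close> moves points towards \<open>w\<close>, while
    \<open>u i\<close> takes at the new points the values of the Moebius map \<open>M\<close> at the
    old ones. A Lipschitz bound uniform in \<open>i\<close> therefore forces
    \<open>M v = M w\<close>, against injectivity of \<open>M\<close>.\<close>
  have uG: "u i ((G ^^ i) v) = M v" if "v \<in> ball w \<delta>" for i v
    unfolding u_def M_def
    by (rule cross_value) (use G(6) \<delta>(3) that nx2 in auto)
  define v where "v = w + of_real (\<delta> / 8)"
  have v: "v \<in> ball w \<delta>" "dist v w = \<delta> / 8" "v \<noteq> w" using \<delta>(1) by (auto simp: v_def dist_norm)
  define L where "L = schottky_bound (norm (M w)) / (\<delta> / 8)"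
  have L: "norm (M v - M w) \<le> L * (\<kappa> ^ i * (\<delta> / 8))" for i
  proof -
    have dd: "dist ((G ^^ i) v) w \<le> \<kappa> ^ i * (\<delta> / 8)" using G(6)[of v i] v \<delta>(3) by auto
    have "\<kappa> ^ i \<le> 1" using G(3,4) by (simp add: power_le_one)
    then have "\<kappa> ^ i * (\<delta> / 8) \<le> 1 * (\<delta> / 8)" using \<delta>(1) by (intro mult_right_mono) auto
    then have d4: "dist w ((G ^^ i) v) \<le> \<delta> / 4"
      unfolding dist_commute[of w] using dd \<delta>(1) by linarith
    have uw: "u i w = M w" using uG[OF ww, of i] Gw by simp
    have "norm (u i ((G ^^ i) v) - u i w) \<le> L * dist w ((G ^^ i) v)"
      unfolding L_def
      by (rule schottky_lipschitz[where u = "u i", OF holu avu _ d4 \<delta>(1)]) (simp_all add: uw)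
    also have "\<dots> \<le> L * (\<kappa> ^ i * (\<delta> / 8))"
      using dd \<delta>(1) by (intro mult_left_mono) (auto simp: L_def schottky_bound_def dist_commute)
    finally show ?thesis using uG[OF v(1)] uw by simp
  qed
  have "(\<lambda>i. L * (\<kappa> ^ i * (\<delta> / 8))) \<longlonglongrightarrow> L * (0 * (\<delta> / 8))"
    by (intro tendsto_intros LIMSEQ_power_zero) (use G(3,4) in auto)
  then have "norm (M v - M w) \<le> L * (0 * (\<delta> / 8))"
    by (rule LIMSEQ_le_const) (use L in auto)
  then have "M v = M w" by simp
  moreover have "(x1 - x2) / (x1 - x) \<noteq> 0" using d by simp
  ultimately have "(v - x) / (v - x2) = (w - x) / (w - x2)"
    unfolding M_def by (metis mult_left_cancel)
  then have "(v - x) * (w - x2) = (w - x) * (v - x2)"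
    using nx2[OF v(1)] nx2[OF ww] by (simp add: frac_eq_eq)
  then have "(x - x2) * (v - w) = 0" by (simp add: algebra_simps)
  then show False using d v by simp
qed

text \<open>A homoclinic orbit from \<open>w\<close> to \<open>w\<close> through \<open>x\<close> yields a contracting inverse branch of an
  iterate which maps a neighbourhood of \<open>x\<close> into itself.\<close>

lemma repelling_points_accumulate:
  assumes w: "nonexceptional w" and rep: "repelling_periodic_point T (Some w)"
    and x: "(T ^^ j) (Some x) = Some w" and B: "open B" "x \<in> B"
  shows "\<exists>v\<in>B. repelling_periodic_point T (Some v)"
proof -
  obtain m \<delta> \<kappa> G where G: "m > 0" "\<delta> > 0" "0 \<le> \<kappa>" "\<kappa> < 1" "G holomorphic_on ball w \<delta>"
    "\<And>v i. v \<in> ball w \<delta> \<Longrightarrow> (G ^^ i) v \<in> ball w \<delta> \<and> dist ((G ^^ i) v) w \<le> \<kappa> ^ i * dist v w \<and>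
      (T ^^ (m * i)) (Some ((G ^^ i) v)) = Some v"
    by (rule contracting_branch[OF w rep]) (rule that; assumption)
  obtain y l where y: "y \<in> ball w \<delta>" "(T ^^ l) (Some y) = Some x"
    using backward_orbit_accumulates[OF w rep x G(2)] by blast
  obtain V1 h1 where h1: "open V1" "w \<in> V1" "h1 holomorphic_on V1" "h1 w = x"
    "\<And>v. v \<in> V1 \<Longrightarrow> (T ^^ j) (Some (h1 v)) = Some v"
    using local_inverse_branch[OF w x] by blast
  obtain V2 h2 where h2: "open V2" "x \<in> V2" "h2 holomorphic_on V2" "h2 x = y"
    "\<And>v. v \<in> V2 \<Longrightarrow> (T ^^ l) (Some (h2 v)) = Some v"
    using local_inverse_branch[OF nonexceptional_preimage[OF w x] y(2)] by blast
  define W where "W = B \<inter> (V2 \<inter> h2 -` ball w \<delta>)"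
  have "open (V2 \<inter> h2 -` ball w \<delta>)"
    using continuous_open_preimage[OF holomorphic_on_imp_continuous_on[OF h2(3)] h2(1) open_ball] .
  then have "open W" "x \<in> W" using B h2 y by (auto simp: W_def)
  then obtain \<epsilon> where \<epsilon>: "\<epsilon> > 0" "ball x \<epsilon> \<subseteq> W" using open_contains_ball by blast
  have "open (V1 \<inter> h1 -` ball x (\<epsilon>/4))"
    using continuous_open_preimage[OF holomorphic_on_imp_continuous_on[OF h1(3)] h1(1) open_ball] .
  moreover have "w \<in> V1 \<inter> h1 -` ball x (\<epsilon>/4)" using h1 \<epsilon>(1) by simp
  ultimately obtain \<eta> where \<eta>: "\<eta> > 0" "ball w \<eta> \<subseteq> V1 \<inter> h1 -` ball x (\<epsilon>/4)"
    using open_contains_ball by blast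
  have "(\<lambda>i. \<kappa> ^ i * \<delta>) \<longlonglongrightarrow> 0 * \<delta>"
    by (intro tendsto_intros LIMSEQ_power_zero) (use G(3,4) in auto)
  then have "\<forall>\<^sub>F i in sequentially. \<kappa> ^ i * \<delta> < \<eta>" using \<eta>(1) by (simp add: order_tendstoD)
  then obtain i0 where i0: "\<And>i. i \<ge> i0 \<Longrightarrow> \<kappa> ^ i * \<delta> < \<eta>" unfolding eventually_sequentially by blast
  \<comment> \<open>The successor makes \<open>i\<close> positive, so the period
    \<open>l + (m * i + j)\<close> is positive even when \<open>l\<close> and \<open>j\<close> are
    0.\<close>
  define i where "i = Suc i0"
  have i: "\<kappa> ^ i * \<delta> < \<eta>" "i > 0" using i0[of i] by (simp_all add: i_def del: power_Suc)
  have Gi: "(G ^^ i) v \<in> ball w \<eta>" if "v \<in> ball w \<delta>" for v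
  proof -
    have "dist ((G ^^ i) v) w \<le> \<kappa> ^ i * dist v w" using G(6)[OF that] by blast
    also have "\<dots> \<le> \<kappa> ^ i * \<delta>" using that G(3) by (intro mult_left_mono) (auto simp: dist_commute)
    finally show ?thesis using i by (simp add: dist_commute)
  qed
  \<comment> \<open>The homoclinic loop run backwards: from near \<open>x\<close> into the disc
    about \<open>w\<close>, towards \<open>w\<close> under \<open>G\<close>, then back close to
    \<open>x\<close>.\<close>
  define \<Phi> where "\<Phi> = h1 \<circ> ((G ^^ i) \<circ> h2)"
  have h2B: "h2 u \<in> ball w \<delta>" "u \<in> V2" if "u \<in> ball x \<epsilon>" for u
    using that \<epsilon>(2) by (auto simp: W_def)
  have hol\<Phi>: "\<Phi> holomorphic_on ball x \<epsilon>"
    unfolding \<Phi>_def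
  proof (rule holomorphic_on_compose_gen[OF holomorphic_on_compose_gen])
    show "h2 holomorphic_on ball x \<epsilon>" using h2B(2) by (intro holomorphic_on_subset[OF h2(3)]) auto
    show "(G ^^ i) holomorphic_on ball w \<delta>"
      by (rule iterates_holomorphic[OF G(5)]) (use G(6) in blast)
    show "h1 holomorphic_on V1" by fact
    show "h2 ` ball x \<epsilon> \<subseteq> ball w \<delta>" using h2B by blast
    show "((G ^^ i) \<circ> h2) ` ball x \<epsilon> \<subseteq> V1" using Gi h2B \<eta>(2) by auto
  qed
  have im\<Phi>: "\<Phi> u \<in> ball x (\<epsilon>/4)" if "u \<in> ball x \<epsilon>" for u
    using Gi[OF h2B(1)[OF that]] \<eta>(2) by (auto simp: \<Phi>_def)
  have T\<Phi>: "(T ^^ (l + (m * i + j))) (Some (\<Phi> u)) = Some u" if "u \<in> ball x \<epsilon>" for u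
  proof -
    have "(T ^^ j) (Some (\<Phi> u)) = Some ((G ^^ i) (h2 u))"
      using h1(5) Gi[OF h2B(1)[OF that]] \<eta>(2) by (auto simp: \<Phi>_def)
    moreover have "(T ^^ (m * i)) (Some ((G ^^ i) (h2 u))) = Some (h2 u)"
      using G(6)[OF h2B(1)[OF that]] by blast
    ultimately show ?thesis using h2(5)[OF h2B(2)[OF that]] by (simp add: funpow_add)
  qed
  have cont: "continuous_on (ball x \<epsilon>) \<Phi>" using hol\<Phi> by (rule holomorphic_on_imp_continuous_on)
  have sub: "cball x (\<epsilon>/2) \<subseteq> ball x \<epsilon>" using \<epsilon> by auto
  \<comment> \<open>Brouwer's theorem supplies a fixed point. A disc of radius
    \<open>\<epsilon>/2\<close> about it is mapped into one of radius \<open>\<epsilon>/4\<close>,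
    so Cauchy's estimate bounds the derivative there by \<open>1/2\<close>.\<close>
  obtain v where v: "v \<in> cball x (\<epsilon>/2)" "\<Phi> v = v"
  proof (rule brouwer_ball[of "\<epsilon>/2" x \<Phi>])
    show "\<Phi> \<in> cball x (\<epsilon>/2) \<rightarrow> cball x (\<epsilon>/2)" using im\<Phi> sub \<epsilon>(1) by fastforce
  qed (use \<epsilon> continuous_on_subset[OF cont sub] in auto)
  have vb: "v \<in> ball x \<epsilon>" using v sub by blast
  have v4: "dist x v < \<epsilon> / 4" using im\<Phi>[OF vb] v(2) by simp
  have subv: "cball v (\<epsilon>/2) \<subseteq> ball x \<epsilon>"
    using v4 \<epsilon>(1) by (auto simp: cball_subset_ball_iff dist_commute)
  have "norm ((deriv ^^ 1) \<Phi> v) \<le> fact 1 * (\<epsilon> / 4) / (\<epsilon> / 2) ^ 1"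
  proof (rule Cauchy_higher_deriv_bound)
    show "\<Phi> holomorphic_on ball v (\<epsilon>/2)"
      using holomorphic_on_subset[OF hol\<Phi>] subv ball_subset_cball by blast
    show "continuous_on (cball v (\<epsilon>/2)) \<Phi>" using continuous_on_subset[OF cont subv] .
    show "\<Phi> u \<in> ball x (\<epsilon>/4)" if "u \<in> ball v (\<epsilon>/2)" for u
      using im\<Phi> that subv ball_subset_cball by blast
  qed (use \<epsilon> in auto)
  then have "norm (deriv \<Phi> v) < 1" using \<epsilon>(1) by simp
  moreover have "\<forall>\<^sub>F u in nhds v. (T ^^ (l + (m * i + j))) (Some (\<Phi> u)) = Some u"
    using eventually_nhds_in_open[OF open_ball vb] by eventually_elim (rule T\<Phi>)
  moreover have "(\<Phi> has_field_derivative deriv \<Phi> v) (at v)"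
    using holomorphic_derivI[OF hol\<Phi> open_ball vb] .
  moreover have "l + (m * i + j) > 0" using G(1) i(2) by simp
  ultimately have "repelling_periodic_point T (Some v)"
    by (intro repelling_periodic_pointI[where n = "l + (m * i + j)" and \<Phi> = \<Phi> and D = "deriv \<Phi> v"] v(2))
  moreover have "v \<in> B" using vb \<epsilon>(2) by (auto simp: W_def)
  ultimately show ?thesis by blast
qed

end

section \<open>Values omitted off the Julia set\<close>

lemma islimpt_Some_closure:
  assumes "Some a \<in> sphere_top closure_of S" "Some a \<notin> S"
  shows "a islimpt {w. Some w \<in> S}"
proof (rule islimptI)
  fix U assume U: "a \<in> U" "open U"
  then have "openin sphere_top (Some ` U)"
    unfolding openin_Alexandroff_compactification by auto
  then obtain y where "y \<in> S" "y \<in> Some ` U"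
    using assms(1) U(1) unfolding in_closure_of by blast
  then show "\<exists>y\<in>{w. Some w \<in> S}. y \<in> U \<and> y \<noteq> a" using assms(2) by auto
qed

context rational_dynamics
begin

definition repelling :: "complex set" where
  "repelling = {w. repelling_periodic_point T (Some w) \<and> nonexceptional w}"

text \<open>An exceptional repelling point is a periodic point on the orbit of infinity or of one of
  the finitely many zeros of the Wronskian, and each orbit contains only finitely many periodic
  points.\<close>

lemma finite_exceptional:
  "finite {w. repelling_periodic_point T (Some w) \<and> \<not> nonexceptional w}" (is "finite ?E")
proof -
  define S where "S = insert None (Some ` {c. poly wronskian c = 0})"
  have finS: "finite S" unfolding S_def using poly_roots_finite[OF wronskian_neq_0] by simp
  have fin: "finite (\<Union>s\<in>S. {x. (\<exists>n. (T ^^ n) s = x) \<and> (\<exists>m>0. (T ^^ m) x = x)})"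
    by (rule finite_UN_I[OF finS finite_periodic_points_in_orbit])
  have "Some ` ?E \<subseteq> (\<Union>s\<in>S. {x. (\<exists>n. (T ^^ n) s = x) \<and> (\<exists>m>0. (T ^^ m) x = x)})"
  proof
    fix x assume "x \<in> Some ` ?E"
    then obtain w where w: "x = Some w" "repelling_periodic_point T (Some w)" "\<not> nonexceptional w" by auto
    obtain m where "m > 0" "(T ^^ m) x = x" using w unfolding repelling_periodic_point_def by blast
    moreover obtain s n where "s \<in> S" "(T ^^ n) s = x"
      using w(1,3) unfolding nonexceptional_def S_def by blast
    ultimately show "x \<in> (\<Union>s\<in>S. {x. (\<exists>n. (T ^^ n) s = x) \<and> (\<exists>m>0. (T ^^ m) x = x)})" by blast
  qed
  then have "finite (Some ` ?E)" using fin finite_subset by blast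
  then show ?thesis by (rule finite_imageD) simp
qed

lemma repelling_periodic_in_julia:
  assumes "repelling_periodic_point T x" shows "x \<in> julia_set T"
proof -
  have "{x. repelling_periodic_point T x} \<subseteq> topspace sphere_top"
    by (auto simp: notin_range_Some)
  then show ?thesis
    unfolding julia_set_def using closure_of_subset assms by blast
qed

lemma omits_repelling:
  assumes B: "open B" "\<And>z. z \<in> B \<Longrightarrow> Some z \<notin> julia_set T" and z: "z \<in> B" and w: "w \<in> repelling"
  shows "(T ^^ n) (Some z) \<noteq> Some w"
proof
  assume "(T ^^ n) (Some z) = Some w"
  then obtain v where v: "v \<in> B" "repelling_periodic_point T (Some v)"
    using repelling_points_accumulate[OF _ _ _ B(1) z] w by (auto simp: repelling_def)
  then show False using B(2) repelling_periodic_in_julia by blast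
qed

end

section \<open>Indifferent fixed points in the Julia set\<close>

locale indifferent_fixed_point = rational_dynamics +
  fixes a \<mu> :: complex
  assumes fixed: "T (Some a) = Some a"
    and mult: "multiplier T (Some a) = \<mu>" and norm_\<mu>: "norm \<mu> = 1"
    and in_julia: "Some a \<in> julia_set T"
begin

lemma fa: "poly q a \<noteq> 0" "f a = a"
  using fixed by (auto simp: T_Some split: if_splits)

lemma f_derivative: "(f has_field_derivative \<mu>) (at a)"
proof -
  have "isCont (poly q) a" by simp
  then have "\<forall>\<^sub>F z in nhds a. poly q z \<noteq> 0"
    using fa(1) tendsto_imp_eventually_ne[of "poly q" "poly q a" "nhds a" 0]
    by (simp add: continuous_at tendsto_nhds_iff)
  then have "\<forall>\<^sub>F z in nhds a. T (Some z) = Some (f z)"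
    by eventually_elim (simp add: T_Some)
  from multiplier_Some[OF fixed this] have "deriv f a = \<mu>" using mult by simp
  then show ?thesis using f_has_field_derivative[OF fa(1)] DERIV_imp_deriv by fastforce
qed

lemma local_iterates: "\<forall>\<^sub>F z in nhds a. (T ^^ n) (Some z) = Some ((f ^^ n) z)"
proof (induction n)
  case (Suc n)
  have d: "((f ^^ n) has_field_derivative \<mu> ^ n) (at a)" "(f ^^ n) a = a"
    using iterates_derivative_at_fixpoint[OF f_derivative fa(2), of n] by auto
  have "isCont (\<lambda>z. poly q ((f ^^ n) z)) a"
    using DERIV_isCont[OF d(1)] by (intro continuous_intros) auto
  then have "\<forall>\<^sub>F z in nhds a. poly q ((f ^^ n) z) \<noteq> 0"
    using fa(1) d(2) tendsto_imp_eventually_ne[of "\<lambda>z. poly q ((f ^^ n) z)" "poly q a" "nhds a" 0]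
    by (simp add: continuous_at tendsto_nhds_iff)
  with Suc show ?case by eventually_elim (simp add: T_Some)
qed simp

lemma fixed_pow: "(T ^^ n) (Some a) = Some a"
  by (induction n) (auto simp: fixed)

lemma not_repelling: "\<not> repelling_periodic_point T (Some a)"
proof -
  have "norm (multiplier (T ^^ n) (Some a)) = 1" for n
  proof -
    have "multiplier (T ^^ n) (Some a) = deriv (f ^^ n) a"
      by (rule multiplier_Some[where T = "T ^^ n", OF fixed_pow local_iterates])
    also have "\<dots> = \<mu> ^ n"
      using iterates_derivative_at_fixpoint[OF f_derivative fa(2), of n] DERIV_imp_deriv by blast
    finally show ?thesis by (simp add: norm_power norm_\<mu>)
  qed
  then show ?thesis unfolding repelling_periodic_point_def by simp
qed

text \<open>As \<open>a\<close> is in the closure of the repelling points without being one, it is a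
  limit point of them, and remains so after the finitely many exceptional ones are
  discarded.\<close>

lemma islimpt_repelling: "a islimpt repelling"
proof -
  have "a islimpt {w. Some w \<in> {x. repelling_periodic_point T x}}"
    by (rule islimpt_Some_closure) (use in_julia not_repelling in \<open>auto simp: julia_set_def\<close>)
  also have "{w. Some w \<in> {x. repelling_periodic_point T x}} =
      {w. repelling_periodic_point T (Some w) \<and> \<not> nonexceptional w} \<union> repelling"
    by (auto simp: repelling_def)
  finally show ?thesis using islimpt_Un_finite[OF finite_exceptional] by blast
qed

text \<open>Near a point mapped to \<open>a\<close> the iterate is an open map, so its image would
  contain members of \<open>repelling\<close>, which accumulate at \<open>a\<close> but are omitted
  off the Julia set.\<close>

lemma omits_fixed_point:
  assumes B: "open B" "\<And>z. z \<in> B \<Longrightarrow> Some z \<notin> julia_set T" and z: "z \<in> B"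
  shows "(T ^^ n) (Some z) \<noteq> Some a"
proof
  assume "(T ^^ n) (Some z) = Some a"
  then have dz: "den n z \<noteq> 0" "val n z = a" by (auto simp: T_pow_eq_Some_iff)
  have "\<forall>\<^sub>F u in nhds z. den n u \<noteq> 0 \<and> u \<in> B"
    using eventually_den_nonzero[OF dz(1)] eventually_nhds_in_open[OF B(1) z] by (rule eventually_conj)
  then obtain e where e: "e > 0" "\<And>u. u \<in> ball z e \<Longrightarrow> den n u \<noteq> 0 \<and> u \<in> B"
    unfolding eventually_nhds_metric by (auto simp: dist_commute)
  have hol: "val n holomorphic_on ball z e"
    unfolding val_def[abs_def] using e(2) by (intro holomorphic_intros holomorphic_num_den) auto
  obtain w0 where w0: "w0 \<in> repelling" "w0 \<noteq> a"
    using islimpt_repelling unfolding islimpt_def by (metis UNIV_I open_UNIV)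
  \<comment> \<open>A constant iterate would, by analytic continuation, send a repelling periodic
    point \<open>w0\<close> other than \<open>a\<close> to the fixed point \<open>a\<close>, from
    which it could not return.\<close>
  have nc: "\<not> val n constant_on ball z e"
  proof
    assume "val n constant_on ball z e"
    then have c: "val n u = a" if "u \<in> ball z e" for u
      using dz(2) e(1) that unfolding constant_on_def by (metis centre_in_ball)
    have "(\<lambda>u. num n u - a * den n u) w0 = 0"
    proof (rule analytic_continuation_open[of "ball z e" UNIV "\<lambda>u. num n u - a * den n u" "\<lambda>_. 0"])
      show "num n u - a * den n u = 0" if "u \<in> ball z e" for u
        using c[OF that] e(2)[OF that] by (auto simp: val_def field_simps)
    qed (use e(1) in \<open>auto intro!: holomorphic_intros holomorphic_num_den\<close>)
    then have w0a: "(T ^^ n) (Some w0) = Some a" by (simp add: T_pow_eq_Some_iff')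
    obtain m where m: "m > 0" "(T ^^ m) (Some w0) = Some w0"
      using w0(1) unfolding repelling_def repelling_periodic_point_def by blast
    have per: "(T ^^ (m * k)) (Some w0) = Some w0" for k
      by (induction k) (simp_all add: funpow_add m(2))
    have "m * Suc n = (m * Suc n - n) + n" using m(1) by (cases m) auto
    then have "(T ^^ (m * Suc n)) (Some w0) = (T ^^ (m * Suc n - n)) ((T ^^ n) (Some w0))"
      by (metis comp_apply funpow_add)
    then show False using per[of "Suc n"] w0a fixed_pow w0(2) by simp
  qed
  have "open (val n ` ball z e)"
    by (rule open_mapping_thm[OF hol open_ball connected_ball open_ball order_refl nc])
  moreover have "a \<in> val n ` ball z e" using dz(2) e(1) by force
  ultimately obtain w where w: "w \<in> repelling" "w \<in> val n ` ball z e"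
    using islimpt_repelling unfolding islimpt_def by meson
  then obtain u where "u \<in> ball z e" "val n u = w" by auto
  then have "u \<in> B" "(T ^^ n) (Some u) = Some w" using e(2) by (auto simp: T_pow_eq_Some_iff)
  then show False using omits_repelling[OF B _ w(1)] by blast
qed

end

section \<open>Covering numbers of planar sets\<close>

lemma covering_number_le:
  assumes "finite C" "F \<subseteq> (\<Union>c\<in>C. ball c r)"
  shows "covering_number r F \<le> card C"
  unfolding covering_number_def by (rule Least_le) (use assms in blast)

lemma covering_number_attained:
  assumes "finite C" "F \<subseteq> (\<Union>c\<in>C. ball c r)"
  obtains C' where "finite C'" "card C' = covering_number r F" "F \<subseteq> (\<Union>c\<in>C'. ball c r)"
proof -
  have "\<exists>C'. finite C' \<and> card C' = covering_number r F \<and> F \<subseteq> (\<Union>c\<in>C'. ball c r)"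
    unfolding covering_number_def by (rule LeastI_ex) (use assms in blast)
  then show thesis using that by blast
qed

text \<open>The centres form a square grid of mesh \<open>r / 2\<close>. The constant 49 arises
  since each side has \<open>2 * k + 1\<close> points, fewer than
  \<open>4 * (R / r) + 3 \<le> 7 * (R / r)\<close>.\<close>

lemma complex_ball_cover:
  fixes x :: complex
  assumes r: "0 < r" "r \<le> R"
  shows "\<exists>C. finite C \<and> real (card C) \<le> 49 * (R / r)\<^sup>2 \<and> ball x R \<subseteq> (\<Union>c\<in>C. ball c r)"
proof -
  define h where "h = r / 2"
  define k where "k = \<lceil>R / h\<rceil>"
  define C where "C = (\<lambda>(i, j). x + Complex (h * of_int i) (h * of_int j)) ` ({-k..k} \<times> {-k..k})"
  have h: "h > 0" using r by (simp add: h_def)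
  have Rh: "R / h = 2 * (R / r)" by (simp add: h_def)
  have R1: "R / r \<ge> 1" using r by simp
  have k: "R / h \<le> of_int k" "of_int k < R / h + 1" unfolding k_def by linarith+
  have kp: "k \<ge> 0" using k Rh R1 by linarith
  have "card C \<le> card ({-k..k} \<times> {-k..k})" unfolding C_def by (rule card_image_le) simp
  also have "\<dots> = nat (2 * k + 1) * nat (2 * k + 1)" by (simp add: card_cartesian_product)
  finally have "real (card C) \<le> real (nat (2 * k + 1)) * real (nat (2 * k + 1))"
    by (metis of_nat_le_iff of_nat_mult)
  also have "real (nat (2 * k + 1)) = of_int (2 * k + 1)" using kp by simp
  also have "of_int (2 * k + 1) * of_int (2 * k + 1) \<le> (7 * (R / r)) * (7 * (R / r))"
    using k Rh R1 kp by (intro mult_mono) auto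
  also have "\<dots> = 49 * (R / r)\<^sup>2" by (simp add: power2_eq_square)
  finally have "real (card C) \<le> 49 * (R / r)\<^sup>2" .
  moreover have "ball x R \<subseteq> (\<Union>c\<in>C. ball c r)"
  proof
    fix y assume y: "y \<in> ball x R"
    define i where "i = round (Re (y - x) / h)"
    define j where "j = round (Im (y - x) / h)"
    have ny: "norm (y - x) < R" using y by (simp add: dist_norm norm_minus_commute)
    have rnd: "\<bar>t - h * of_int (round (t / h))\<bar> \<le> h / 2 \<and> round (t / h) \<in> {-k..k}"
      if "\<bar>t\<bar> < R" for t
    proof -
      have a: "\<bar>of_int (round (t / h)) - t / h\<bar> \<le> 1 / 2" by (rule of_int_round_abs_le)
      have "t - h * of_int (round (t / h)) = - h * (of_int (round (t / h)) - t / h)"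
        using h by (simp add: field_simps)
      then have "\<bar>t - h * of_int (round (t / h))\<bar> = h * \<bar>of_int (round (t / h)) - t / h\<bar>"
        using h by (simp add: abs_mult)
      also have "\<dots> \<le> h * (1 / 2)" using a h by (intro mult_left_mono) auto
      finally have 1: "\<bar>t - h * of_int (round (t / h))\<bar> \<le> h / 2" by simp
      have "\<bar>t / h\<bar> < R / h" using that h by (simp add: abs_divide divide_strict_right_mono)
      then have "\<bar>of_int (round (t / h)) :: real\<bar> < of_int k + 1" using a k by linarith
      then have "\<bar>round (t / h)\<bar> < k + 1" by linarith
      then show ?thesis using 1 by auto
    qed
    have ri: "\<bar>Re (y - x) - h * of_int i\<bar> \<le> h / 2" "i \<in> {-k..k}"
      unfolding i_def using rnd[of "Re (y - x)"] abs_Re_le_cmod[of "y - x"] ny by linarith+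
    have rj: "\<bar>Im (y - x) - h * of_int j\<bar> \<le> h / 2" "j \<in> {-k..k}"
      unfolding j_def using rnd[of "Im (y - x)"] abs_Im_le_cmod[of "y - x"] ny by linarith+
    define c where "c = x + Complex (h * of_int i) (h * of_int j)"
    have "c \<in> C" unfolding C_def c_def using ri(2) rj(2) by force
    moreover have "norm (y - c) \<le> \<bar>Re (y - c)\<bar> + \<bar>Im (y - c)\<bar>" by (rule cmod_le)
    then have "norm (y - c) < r" using ri(1) rj(1) h by (simp add: c_def h_def diff_diff_eq)
    then have "y \<in> ball c r" by (simp add: dist_norm norm_minus_commute)
    ultimately show "y \<in> (\<Union>c\<in>C. ball c r)" by blast
  qed
  moreover have "finite C" by (simp add: C_def)
  ultimately show ?thesis by blast
qed

lemma covering_number_planar: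
  fixes F :: "complex set"
  assumes "0 < r" "r < R"
  shows "real (covering_number r (ball x R \<inter> F)) \<le> 49 * (R / r) powr 2"
proof -
  obtain C where C: "finite C" "real (card C) \<le> 49 * (R / r)\<^sup>2" "ball x R \<subseteq> (\<Union>c\<in>C. ball c r)"
    using complex_ball_cover[of r R x] assms by auto
  then have "covering_number r (ball x R \<inter> F) \<le> card C" by (intro covering_number_le) auto
  then have "real (covering_number r (ball x R \<inter> F)) \<le> 49 * (R / r)\<^sup>2" using C(2) by linarith
  then show ?thesis using assms by (simp add: powr_numeral)
qed

text \<open>If every disc of radius \<open>c R\<close> in \<open>ball x R\<close> met \<open>F\<close>, comparing areas would show that at least
  \<open>1 / (16 c\<^sup>2)\<close> discs of radius \<open>c R\<close> are needed to cover \<open>ball x R \<inter> F\<close>.\<close>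

lemma holes_of_covering_bound:
  fixes F :: "complex set"
  assumes s: "s < 2" and K: "0 < K"
    and cov: "\<And>r R. 0 < r \<Longrightarrow> r < R \<Longrightarrow> R < D \<Longrightarrow>
      real (covering_number r (ball x R \<inter> F)) \<le> K * (R / r) powr s"
  shows "\<exists>c. 0 < c \<and> c \<le> 1 \<and> (\<forall>R. 0 < R \<longrightarrow> R < D \<longrightarrow> (\<exists>z. ball z (c * R) \<subseteq> ball x R - F))"
proof -
  \<comment> \<open>The bound \<open>1/2\<close> keeps discs of radius \<open>c * R\<close> about
    points of \<open>ball x (R/2)\<close> inside \<open>ball x R\<close>. The other one makes
    \<open>16 * K * c powr (2 - s)\<close> at most \<open>1/2\<close>, whereas comparing areas shows
    it to be at least 1 if there is no hole.\<close>
  define c where "c = min (1/2) ((1 / (32 * K)) powr (1 / (2 - s)))"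
  have c: "0 < c" "c \<le> 1/2" using K by (auto simp: c_def)
  have "c powr (2 - s) \<le> ((1 / (32 * K)) powr (1 / (2 - s))) powr (2 - s)"
    using s c by (intro powr_mono2) (auto simp: c_def)
  also have "\<dots> = 1 / (32 * K)" using s K by (simp add: powr_powr)
  finally have cs: "c powr (2 - s) \<le> 1 / (32 * K)" .
  have "\<exists>z. ball z (c * R) \<subseteq> ball x R - F" if R: "0 < R" "R < D" for R
  proof (rule ccontr)
    assume no: "\<not> ?thesis"
    define r where "r = c * R"
    have "c * R < 1 * R" using c R by (intro mult_strict_right_mono) auto
    then have r: "0 < r" "r < R" using c R by (auto simp: r_def)
    obtain C0 where C0: "finite C0" "ball x R \<subseteq> (\<Union>c\<in>C0. ball c r)"
      using complex_ball_cover[of r R x] r by auto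
    then have "ball x R \<inter> F \<subseteq> (\<Union>c\<in>C0. ball c r)" by blast
    then obtain C where C: "finite C" "card C = covering_number r (ball x R \<inter> F)"
      "ball x R \<inter> F \<subseteq> (\<Union>c\<in>C. ball c r)"
      using covering_number_attained[OF C0(1)] by metis
    \<comment> \<open>Each point of the smaller disc is within \<open>r\<close> of a point of
      \<open>F\<close>, hence within \<open>2 * r\<close> of a centre of the cover.\<close>
    have sub: "ball x (R/2) \<subseteq> (\<Union>b\<in>C. ball b (2 * r))"
    proof
      fix y assume y: "y \<in> ball x (R/2)"
      have "c * R \<le> 1/2 * R" using c R by (intro mult_right_mono) auto
      then have "ball y r \<subseteq> ball x R"
        using y by (auto simp: ball_subset_ball_iff r_def dist_commute)
      then obtain u where u: "u \<in> ball y r" "u \<in> F" "u \<in> ball x R"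
        using no unfolding r_def by blast
      then obtain b where b: "b \<in> C" "u \<in> ball b r" using C(3) by blast
      have "dist b y \<le> dist b u + dist u y" by (rule dist_triangle)
      then have "y \<in> ball b (2 * r)" using u b by (simp add: dist_commute)
      then show "y \<in> (\<Union>b\<in>C. ball b (2 * r))" using b by blast
    qed
    define v where "v = unit_ball_vol (real 2)"
    have v: "v > 0" by (simp add: v_def)
    have cb: "measure lborel (ball z t) = v * t\<^sup>2" if "t \<ge> 0" for z :: complex and t
      using content_ball[OF that, of z] by (simp add: v_def)
    have "v * (R/2)\<^sup>2 = measure lborel (ball x (R/2))" using cb R by simp
    also have "\<dots> \<le> measure lborel (\<Union>b\<in>C. ball b (2 * r))"
      using sub C(1)
      by (intro measure_mono_fmeasurable fmeasurable.finite_UN fmeasurableI emeasure_bounded_finite) auto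
    also have "\<dots> \<le> (\<Sum>b\<in>C. measure lborel (ball b (2 * r)))"
      using C(1) by (intro measure_UNION_le) auto
    also have "\<dots> = real (card C) * (v * (2 * r)\<^sup>2)" using cb r by simp
    finally have "v * (R/2)\<^sup>2 \<le> v * (real (card C) * (2 * r)\<^sup>2)" by (simp add: mult.left_commute)
    then have "(R/2)\<^sup>2 \<le> real (card C) * (2 * r)\<^sup>2" using v by simp
    then have "R\<^sup>2 * 1 \<le> R\<^sup>2 * (real (card C) * 16 * c\<^sup>2)"
      by (simp add: r_def power_mult_distrib power_divide mult_ac)
    then have low: "1 \<le> real (card C) * 16 * c\<^sup>2" using R by (simp only: mult_le_cancel_left_pos zero_less_power)
    have "real (card C) \<le> K * (R / r) powr s" using cov[OF r R(2)] C(2) by simp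
    also have "R / r = 1 / c" using R by (simp add: r_def)
    also have "(1 / c) powr s = c powr (- s)" using c by (simp add: powr_minus_divide powr_divide)
    finally have "real (card C) * 16 * c\<^sup>2 \<le> K * c powr (- s) * 16 * c\<^sup>2"
      by (intro mult_right_mono) auto
    also have "c\<^sup>2 = c powr 2" using c by (simp add: powr_numeral)
    also have "K * c powr (- s) * 16 * c powr 2 = 16 * K * c powr (2 - s)"
      using powr_add[of c "- s" 2] by (simp add: mult_ac)
    also have "\<dots> \<le> 16 * K * (1 / (32 * K))" using cs K by (intro mult_left_mono) auto
    also have "\<dots> = 1/2" using K by simp
    finally show False using low \<open>c\<^sup>2 = c powr 2\<close> by simp
  qed
  then show ?thesis using c by (intro exI[of _ c]) auto
qed

text \<open>The exponent 2 is admissible for every planar set, so only smaller exponents have to be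
  excluded.\<close>

lemma assouad_dim_eq_2I:
  fixes F :: "complex set"
  assumes "\<And>s K. 0 \<le> s \<Longrightarrow> s < 2 \<Longrightarrow> 0 < K \<Longrightarrow>
     (\<And>r R x. 0 < r \<Longrightarrow> r < R \<Longrightarrow> (bounded F \<longrightarrow> R < diameter F) \<Longrightarrow> x \<in> F \<Longrightarrow>
       real (covering_number r (ball x R \<inter> F)) \<le> K * (R / r) powr s) \<Longrightarrow> False"
  shows "assouad_dim F = 2"
  unfolding assouad_dim_def
proof (rule cInf_eq_minimum)
  show "2 \<in> {s. s \<ge> 0 \<and>
       (\<exists>C>0. \<forall>r R. 0 < r \<and> r < R \<and> (bounded F \<longrightarrow> R < diameter F) \<longrightarrow>
          (\<forall>x\<in>F. real (covering_number r (ball x R \<inter> F)) \<le> C * (R / r) powr s))}"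
    using covering_number_planar by (auto intro!: exI[of _ 49])
next
  fix s assume "s \<in> {s. s \<ge> 0 \<and>
       (\<exists>C>0. \<forall>r R. 0 < r \<and> r < R \<and> (bounded F \<longrightarrow> R < diameter F) \<longrightarrow>
          (\<forall>x\<in>F. real (covering_number r (ball x R \<inter> F)) \<le> C * (R / r) powr s))}"
  then obtain K where "s \<ge> 0" "K > 0" "\<And>r R x. 0 < r \<Longrightarrow> r < R \<Longrightarrow> (bounded F \<longrightarrow> R < diameter F) \<Longrightarrow> x \<in> F \<Longrightarrow>
       real (covering_number r (ball x R \<inter> F)) \<le> K * (R / r) powr s"
    by blast
  then show "2 \<le> s" using assms[of s K] by (meson not_le_imp_less)
qed

section \<open>Cremer points\<close>

context indifferent_fixed_point
begin

text \<open>Porosity of \<open>J\<close> at \<open>a\<close>, which a dimension below 2 forces, is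
  all that the argument uses of the dimension.\<close>

lemma linearisable_if_holes:
  assumes \<alpha>: "\<alpha> \<notin> \<rat>" "\<mu> = exp (2 * of_real pi * \<i> * of_real \<alpha>)"
    and J: "julia_set T = Some ` J" and c: "0 < c" "c \<le> 1" and "0 < D"
    and holes: "\<And>R. 0 < R \<Longrightarrow> R < D \<Longrightarrow> \<exists>z. ball z (c * R) \<subseteq> ball a R - J"
  shows "locally_conjugate_to_linear T (Some a) \<mu>"
proof -
  define F where "F = (\<lambda>w. f (a + w) - a)"
  define S where "S = {w. poly q (a + w) \<noteq> 0}"
  have S: "open S" "0 \<in> S"
    unfolding S_def using fa by (auto intro!: open_Collect_neq continuous_intros)
  have holF: "F holomorphic_on S"
    unfolding F_def S_def by (intro holomorphic_intros) auto
  have F0: "F 0 = 0" using fa by (simp add: F_def)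
  have derF: "(F has_field_derivative \<mu>) (at 0)"
  proof -
    have "((\<lambda>w. f (a + w)) has_field_derivative \<mu>) (at 0)"
      using DERIV_shift[of f \<mu> 0 a] f_derivative by (simp add: add.commute)
    from DERIV_diff[OF this DERIV_const[of a]] show ?thesis by (simp add: F_def)
  qed
  have \<mu>0: "\<mu> \<noteq> 0" using \<alpha>(2) by simp
  have dF: "deriv F 0 = \<mu>" using derF by (rule DERIV_imp_deriv)
  have TF: "T (Some (a + w)) = Some (a + F w)" if "w \<in> S" for w
    using that by (simp add: S_def F_def T_Some)

  \<comment> \<open>Two repelling points serve with \<open>a\<close> as the three omitted values;
    the strict inequality of distances makes them distinct.\<close>
  obtain p1 where p1: "p1 \<in> repelling" "p1 \<noteq> a"
    using islimpt_repelling unfolding islimpt_def by (metis UNIV_I open_UNIV)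
  obtain p2 where p2: "p2 \<in> repelling" "p2 \<noteq> a" "dist p2 a < dist p1 a"
    using islimpt_repelling p1(2) unfolding islimpt_approachable by (metis dist_pos_lt)
  have p12: "p1 \<noteq> p2" using p2(3) by auto
  \<comment> \<open>With these constants the cross ratio sending \<open>p2\<close>,
    \<open>p1\<close>, \<open>a\<close> to 0, 1, infinity is \<open>\<kappa> * (y - b) / y\<close>
    at the point \<open>a + y\<close>.\<close>
  define \<kappa> where "\<kappa> = (p1 - a) / (p1 - p2)"
  define b where "b = p2 - a"
  have \<kappa>: "\<kappa> \<noteq> 0" using p1 p12 by (simp add: \<kappa>_def)
  have b: "norm b > 0" using p2 by (simp add: b_def)
  define u where "u = (\<lambda>k w. cross p2 p1 a k (a + w))"

  define \<Omega> where "\<Omega> = {w. \<forall>n. \<forall>x\<in>insert a repelling. (T ^^ n) (Some (a + w)) \<noteq> Some x}"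
  have "(T ^^ 0) (Some (a + 0)) = Some a" by simp
  then have "0 \<notin> \<Omega>" unfolding \<Omega>_def by blast
  have holes': "\<exists>z. ball z (c * R) \<subseteq> \<Omega> \<inter> ball 0 R" if R: "0 < R" "R < D" for R
  proof -
    obtain z where z: "ball z (c * R) \<subseteq> ball a R - J" using holes[OF R] by blast
    have noJ: "Some v \<notin> julia_set T" if "v \<in> ball z (c * R)" for v
      using that z J by auto
    have "ball (z - a) (c * R) \<subseteq> \<Omega> \<inter> ball 0 R"
    proof
      fix w assume "w \<in> ball (z - a) (c * R)"
      then have w: "a + w \<in> ball z (c * R)" by (simp add: dist_norm algebra_simps)
      then have "a + w \<in> ball a R" using z by blast
      moreover have "w \<in> \<Omega>"
        unfolding \<Omega>_def using omits_repelling[OF open_ball noJ w] omits_fixed_point[OF open_ball noJ w]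
        by auto
      ultimately show "w \<in> \<Omega> \<inter> ball 0 R" by (simp add: dist_norm)
    qed
    then show ?thesis by blast
  qed
  have \<Omega>_omits: "(T ^^ k) (Some (a + w)) \<noteq> Some x" if "w \<in> \<Omega>" "x \<in> {a, p1, p2}" for w k x
    using that p1 p2 by (auto simp: \<Omega>_def)

  have dF0: "deriv F 0 \<noteq> 0" using dF \<mu>0 by simp
  obtain V g where g: "open V" "F 0 \<in> V" "g holomorphic_on V" "g ` V \<subseteq> S"
    "\<And>v. v \<in> V \<Longrightarrow> F (g v) = v" "g (F 0) = 0"
    by (rule local_holomorphic_inverse[OF holF S dF0]) (rule that; assumption)
  have dg: "(g has_field_derivative exp (2 * of_real pi * \<i> * of_real (- \<alpha>))) (at 0)"
  proof -
    have d: "(g has_field_derivative deriv g 0) (at 0)"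
      using holomorphic_derivI[OF g(3,1,2)] F0 by simp
    have "((\<lambda>v. F (g v)) has_field_derivative \<mu> * deriv g 0) (at 0)"
      by (rule DERIV_chain2[where f = F and g = g]) (use derF d g(6) F0 in auto)
    moreover have "\<forall>\<^sub>F v in nhds 0. F (g v) = v"
      using eventually_nhds_in_open[OF g(1,2)] unfolding F0 by eventually_elim (rule g(5))
    ultimately have "((\<lambda>v. v) has_field_derivative \<mu> * deriv g 0) (at 0)"
      using DERIV_cong_ev[of 0 0 "\<lambda>v. F (g v)" "\<lambda>v. v"] by auto
    then have "\<mu> * deriv g 0 = 1" using DERIV_unique DERIV_ident by blast
    moreover have "\<mu> * exp (2 * of_real pi * \<i> * of_real (- \<alpha>)) = 1"
      unfolding \<alpha>(2) by (simp flip: exp_add)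
    ultimately have "deriv g 0 = exp (2 * of_real pi * \<i> * of_real (- \<alpha>))"
      using \<mu>0 by (metis mult_left_cancel)
    then show ?thesis using d by simp
  qed
  \<comment> \<open>Since \<open>F (g w) = w\<close>, the orbit of \<open>a + w\<close> is the tail
    of that of \<open>a + g w\<close>, so it omits whatever the latter omits.\<close>
  have inv: "\<forall>\<^sub>F w in nhds 0. g w \<in> \<Omega> \<longrightarrow> w \<in> \<Omega>"
    using eventually_nhds_in_open[OF g(1,2)] unfolding F0
  proof eventually_elim
    case (elim w)
    have "g w \<in> S" using elim g(4) by blast
    then have eq: "(T ^^ Suc n) (Some (a + g w)) = (T ^^ n) (Some (a + w))" for n
      using TF[of "g w"] g(5)[OF elim] by (simp add: funpow_swap1)
    show ?case
    proof
      assume "g w \<in> \<Omega>"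
      then have "(T ^^ Suc n) (Some (a + g w)) \<noteq> Some x" if "x \<in> insert a repelling" for n x
        using that unfolding \<Omega>_def by blast
      then show "w \<in> \<Omega>" unfolding eq \<Omega>_def by blast
    qed
  qed

  obtain e where e: "e > 0" "ball 0 e \<subseteq> S" "inj_on F (ball 0 e)"
    by (rule has_complex_derivative_locally_injective[OF holF S(2,1) dF0]) (rule that; assumption)
  have "(F has_derivative (\<lambda>w. \<mu> * w)) (at 0)"
    using derF by (simp add: has_field_derivative_def)
  then obtain e' where e': "e' > 0" "\<And>w. norm (w - 0) < e' \<Longrightarrow>
      norm (F w - F 0 - \<mu> * (w - 0)) \<le> 1 * norm (w - 0)"
    unfolding has_derivative_at_alt by (metis zero_less_one)
  \<comment> \<open>Within \<open>e\<close> the map \<open>F\<close> is injective, so 0 is its only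
    zero; within \<open>e'\<close> it at most doubles the modulus; the last bound gives
    \<open>4 * \<rho> \<le> norm b\<close>.\<close>
  define \<rho> where "\<rho> = min (min e e') (norm b / 4)"
  have \<rho>: "0 < \<rho>" "\<rho> \<le> e" "\<rho> \<le> e'" "4 * \<rho> \<le> norm b" using e(1) e'(1) b by (auto simp: \<rho>_def)
  have \<rho>S: "ball 0 \<rho> \<subseteq> S" using e(2) \<rho>(2) by auto
  have nz: "z = 0" if "z \<in> ball 0 \<rho>" "F z = 0" for z
    using inj_onD[OF e(3), of z 0] that F0 \<rho>(1,2) by auto
  have bd: "norm (F z) \<le> 2 * \<rho>" if "z \<in> ball 0 \<rho>" for z
  proof -
    have "norm (F z - \<mu> * z) \<le> norm z" using e'(2)[of z] that \<rho>(3) F0 by simp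
    moreover have "norm (\<mu> * z) = norm z" by (simp add: norm_mult norm_\<mu>)
    ultimately have "norm (F z) \<le> norm z + norm z"
      by (metis add_mono diff_add_cancel norm_triangle_ineq order_refl order_trans)
    then show ?thesis using that by simp
  qed

  define B where "B = norm \<kappa> * (2 * \<rho> + norm b) / \<rho>"
  \<comment> \<open>\<open>B'\<close> depends on \<open>c\<close> and \<open>B\<close> but not on
    \<open>s\<close>, so the radius can be chosen afterwards, below
    \<open>2 * \<rho> * norm \<kappa> / B'\<close>.\<close>
  obtain B' where B': "B' > 0" "\<And>u s z w. 0 < s \<Longrightarrow> u holomorphic_on {v. \<bar>norm v - s\<bar> < c / 2 * s} \<Longrightarrow>
    (\<And>v. \<bar>norm v - s\<bar> < c / 2 * s \<Longrightarrow> u v \<noteq> 0 \<and> u v \<noteq> 1) \<Longrightarrow> norm z = s \<Longrightarrow> norm w = s \<Longrightarrow>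
    norm (u z) \<le> B \<Longrightarrow> norm (u w) \<le> B'"
    using schottky_circle[of "c/2" B] c(1) by auto
  define \<sigma> where "\<sigma> = min \<rho> (2 * \<rho> * norm \<kappa> / B')"
  have \<sigma>: "0 < \<sigma>" using \<rho>(1) \<kappa> B'(1) by (simp add: \<sigma>_def)
  have \<alpha>': "- \<alpha> \<notin> \<rat>" using \<alpha>(1) Rats_minus_iff by blast
  have g0: "g 0 = 0" using g(6) F0 by simp
  obtain s where s: "0 < s" "s < \<sigma>" "{w. \<bar>norm w - s\<bar> < c / 2 * s} \<subseteq> \<Omega>"
    using holes_to_annulus[OF \<alpha>' dg g0 inv \<open>0 \<notin> \<Omega>\<close> c \<open>0 < D\<close> holes' \<sigma>] by blast
  have circle: "w \<in> \<Omega>" if "norm w = s" for w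
    using s(1,3) c(1) that by auto

  have holu: "u k holomorphic_on {w. \<bar>norm w - s\<bar> < c / 2 * s}" for k
  proof -
    have "(cross p2 p1 a k \<circ> (\<lambda>w. a + w)) holomorphic_on {w. \<bar>norm w - s\<bar> < c / 2 * s}"
    proof (rule holomorphic_on_compose_gen)
      show "cross p2 p1 a k holomorphic_on (\<lambda>w. a + w) ` \<Omega>"
        by (rule cross_holomorphic) (use \<Omega>_omits in auto)
    qed (use s(3) in \<open>auto intro!: holomorphic_intros\<close>)
    then show ?thesis by (simp add: u_def comp_def)
  qed
  have avu: "u k w \<noteq> 0 \<and> u k w \<noteq> 1" if "\<bar>norm w - s\<bar> < c / 2 * s" for k w
  proof -
    have "w \<in> \<Omega>" using s(3) that by blast
    then show ?thesis
      unfolding u_def using p12 p1(2) p2(2) \<Omega>_omits by (intro cross_omits) auto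
  qed
  \<comment> \<open>While the orbit stays in \<open>ball 0 \<rho>\<close> it meets no pole, so
    \<open>T ^^ k\<close> is \<open>F ^^ k\<close> up to translation; membership in \<Omega> keeps
    the denominator nonzero.\<close>
  have uF: "u k w = \<kappa> * ((F ^^ k) w - b) / (F ^^ k) w"
    if w: "norm w = s" and small: "\<forall>j<k. (F ^^ j) w \<in> ball 0 \<rho>" for k w
  proof -
    have "(T ^^ i) (Some (a + w)) = Some (a + (F ^^ i) w)" if "i \<le> k" for i
      using that
    proof (induction i)
      case (Suc i)
      then have "(F ^^ i) w \<in> S" using small \<rho>S by auto
      then show ?case using Suc TF by simp
    qed simp
    then have Tk: "(T ^^ k) (Some (a + w)) = Some (a + (F ^^ k) w)" by simp
    then have "a + (F ^^ k) w \<noteq> a" using \<Omega>_omits[OF circle[OF w], of a k] by auto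
    from cross_value[OF Tk this, of p2 p1] show ?thesis
      by (simp add: u_def \<kappa>_def b_def algebra_simps)
  qed
  have trap: "(F ^^ k) z \<in> ball 0 \<rho>" if "z \<in> ball 0 s" for k z
  proof (rule iterates_trapped[where f = F and u = u and b = b and \<kappa> = \<kappa> and B' = B' and s = s])
    show "F holomorphic_on ball 0 \<rho>" using holF \<rho>S holomorphic_on_subset by blast
    show "norm (u k w) \<le> B'" if "norm z = s" "norm w = s"
      "norm (u k z) \<le> norm \<kappa> * (2 * \<rho> + norm b) / \<rho>" for k z w
      by (rule B'(2)[of s "u k" z w]) (use s(1) holu avu that in \<open>auto simp: B_def\<close>)
  qed (use F0 derF norm_\<mu> nz bd s \<sigma>_def uF \<rho> \<kappa> B' that in auto)
  have "F holomorphic_on ball 0 \<rho>" using holF \<rho>S holomorphic_on_subset by blast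
  then obtain U h where U: "open U" "0 \<in> U" "h holomorphic_on U" "inj_on h U" "h 0 = 0"
    "\<forall>\<^sub>F w in nhds 0. F w \<in> U \<and> h (F w) = \<mu> * h w"
    using linearisation_of_bounded_iterates[OF _ F0 derF norm_\<mu> s(1) trap] by blast
  have "\<forall>\<^sub>F w in nhds 0. local_rep T (Some a) w = F w"
    using eventually_nhds_in_open[OF S]
    by eventually_elim (simp add: local_rep_def chart_def chart_inv_def TF)
  with U(6) have "\<forall>\<^sub>F w in nhds 0. local_rep T (Some a) w \<in> U \<and> h (local_rep T (Some a) w) = \<mu> * h w"
    by eventually_elim simp
  then show ?thesis unfolding locally_conjugate_to_linear_def using U by blast
qed

end

theorem theorem3p3:
  fixes T :: "sphere \<Rightarrow> sphere" and d :: nat and J :: "complex set" and \<omega> :: sphere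
  assumes "rational_map_of_degree T d" and "d \<ge> 2"
    and "julia_set T \<noteq> UNIV"
    and "julia_set T = Some ` J" and "compact J"
    and "\<omega> \<in> julia_set T" and "cremer_point T \<omega>"
  shows "assouad_dim J = 2"
proof -
  obtain p q where pq: "coprime p q" "max (degree p) (degree q) = d" "T = rational_fun p q"
    using assms(1) unfolding rational_map_of_degree_def by blast
  obtain a where a: "\<omega> = Some a" "a \<in> J" using assms(4,6) by auto
  obtain \<alpha> :: real where \<alpha>: "\<alpha> \<notin> \<rat>"
    "multiplier T \<omega> = exp (2 * of_real pi * \<i> * of_real \<alpha>)"
    "\<not> locally_conjugate_to_linear T \<omega> (exp (2 * of_real pi * \<i> * of_real \<alpha>))" "T \<omega> = \<omega>"
    using assms(7) unfolding cremer_point_def by blast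
  define \<mu> where "\<mu> = exp (2 * of_real pi * \<i> * complex_of_real \<alpha>)"
  interpret indifferent_fixed_point p q d a \<mu>
    by unfold_locales (use pq assms(2,6) a(1) \<alpha> in \<open>auto simp: \<mu>_def\<close>)
  \<comment> \<open>A second point of \<open>J\<close> makes the diameter positive, so that the
    covering bound applies at some scales about \<open>a\<close>.\<close>
  obtain w where w: "w \<in> repelling" "w \<noteq> a"
    using islimpt_repelling unfolding islimpt_def by (metis UNIV_I open_UNIV)
  have "Some w \<in> julia_set T"
    using w(1) repelling_periodic_in_julia pq(3) by (simp add: repelling_def)
  then have "w \<in> J" using assms(4) by auto
  have bJ: "bounded J" using assms(5) by (rule compact_imp_bounded)
  have "0 < dist w a" using w(2) by simp
  also have "\<dots> \<le> diameter J" using diameter_bounded_bound[OF bJ \<open>w \<in> J\<close> a(2)] .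
  finally have D: "0 < diameter J" .
  show ?thesis
  proof (rule assouad_dim_eq_2I)
    fix s K :: real
    assume s: "s < 2" "0 < K" and cov: "\<And>r R x. 0 < r \<Longrightarrow> r < R \<Longrightarrow>
      (bounded J \<longrightarrow> R < diameter J) \<Longrightarrow> x \<in> J \<Longrightarrow>
      real (covering_number r (ball x R \<inter> J)) \<le> K * (R / r) powr s"
    obtain c where c: "0 < c" "c \<le> 1"
      "\<And>R. 0 < R \<Longrightarrow> R < diameter J \<Longrightarrow> \<exists>z. ball z (c * R) \<subseteq> ball a R - J"
      using holes_of_covering_bound[OF s, of "diameter J" a J] cov a(2) by blast
    have "locally_conjugate_to_linear T (Some a) \<mu>"
      unfolding pq(3)
      by (rule linearisable_if_holes[OF \<alpha>(1) \<mu>_def _ c(1,2) D c(3)]) (use assms(4) pq(3) in auto)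
    then show False using \<alpha>(3) a(1) by (simp add: \<mu>_def)
  qed
qed

end
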